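(* Let $F:\mathbb{R}^n\times\mathbb{R}^m\to\mathbb{R}^n$ be $C^1$ with $F(0,0)=0$ and with continuous second order partial derivatives with respect to the components of $u$, and set $f(x)=F(x,0)$, $g(x)=\frac{\partial F}{\partial u}(x,0)$ (sufficiently smooth, at least $C^1$). Assume that, for some vector field $G:\mathbb{R}^n\to\mathbb{R}^n$ and some function $V:\mathbb{R}^n\to\mathbb{R}$: (A1) $V$ is smooth, positive definite and radially unbounded, and $L_fV(x)\le0$ for all $x\in\mathbb{R}^n$. (A2) For every $x\ne0$ with $L_gV(x)=0$, either $L_fL_GV(x)<0$ or $L_fV(x)<0$. (A3) There is a positive, nondecreasing, smooth function $\mathcal{D}:[0,\infty)\to(0,\infty)$ such that $\int_0^{+\infty}\frac{ds}{\mathcal{D}(s)}=+\infty$ and $|L_gV(x)|\le\mathcal{D}(V(x))$ for all $x\in\mathbb{R}^n$. Let $\varepsilon>0$. Then there exist smooth functions $\delta,\xi:[0,\infty)\to[0,\infty)$ such that, with $K(x)=-\xi(V(x))\,L_gV(x)^\top$: (i) the system $$\dot x=f(x)+g(x)[K(x)+d]$$ with disturbance $d\in\mathbb{R}^m$ is integral-input-to-state stable (iISS) and has a smooth iISS-CLF of the form $$\tilde U(x)=\int_0^{U(x)}\frac{dp}{\tilde{\mathcal{D}}(p)},\qquad U(x)=V(x)+\delta(V(x))\,L_GV(x),\qquad \tilde{\mathcal{D}}(p)=\mathcal{D}(2p)+1;$$ (ii) $|K(x)|\le\varepsilon$ for all $x\in\mathbb{R}^n$.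
   Context: Notation: $\nabla V$ is the gradient as a row vector; $L_fV=\nabla V\,f$; $L_gV=\nabla V\,g$ is a row vector with $m$ components; $L_fL_GV=L_f(L_GV)$. Positive definite means zero at $0$ and positive elsewhere; radially unbounded means tending to $+\infty$ as $|x|\to\infty$. All functions ($f$, $g$, $G$ included) are assumed sufficiently smooth for the assertions to make sense (in particular $G$ is smooth enough that $\tilde U$ is smooth whenever $\delta$ is). $\mathcal{K}_\infty$ is the class of continuous strictly increasing unbounded functions $[0,\infty)\to[0,\infty)$ vanishing at $0$; $\mathcal{K}$ is the same class without the unboundedness requirement; $\mathcal{KL}$ is the class of continuous $\beta:[0,\infty)^2\to[0,\infty)$ with $\beta(\cdot,t)\in\mathcal{K}$ for each $t$ and $\beta(s,\cdot)$ decreasing to $0$ for each $s$. iISS: a system $\dot x=\Phi(x,d)$ on $\mathbb{R}^n\times\mathbb{R}^m$ is integral-input-to-state stable if there exist $\beta\in\mathcal{KL}$ and $\alpha,\gamma\in\mathcal{K}_\infty$ such that for all measurable locally essentially bounded $\mathbf{d}:[0,\infty)\to\mathbb{R}^m$ and all corresponding trajectories $x(t)$ of $\dot x(t)=\Phi(x(t),\mathbf{d}(t))$, $$\alpha(|x(t)|)\le\beta(|x(0)|,t)+\int_0^t\gamma(|\mathbf{d}(s)|)\,ds\qquad\forall t\ge0.$$ iISS-CLF: for $\dot x=\Phi(x,d)$, a positive definite, radially unbounded function $W$ for which there exist a continuous positive definite function $\alpha_5:[0,\infty)\to[0,\infty)$ and $\sigma\in\mathcal{K}$ with $\nabla W(x)\Phi(x,d)\le-\alpha_5(|x|)+\sigma(|d|)$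 for all $x\in\mathbb{R}^n$, $d\in\mathbb{R}^m$. *)

theory Defs
  imports "HOL-Analysis.Analysis"
begin

(* Used only for S = UNIV and S = {0..}, where derivatives within S are unique; on {0..} the
   derivatives at 0 are one-sided.  The directional derivatives of a differentiable function
   are the linear combinations of its partial derivatives. *)
primrec C_k_on :: "nat \<Rightarrow> 'a::euclidean_space set \<Rightarrow> ('a \<Rightarrow> 'b::real_normed_vector) \<Rightarrow> bool" where
  "C_k_on 0 S f \<longleftrightarrow> continuous_on S f"
| "C_k_on (Suc k) S f \<longleftrightarrow>
     f differentiable_on S \<and> (\<forall>v. C_k_on k S (\<lambda>x. frechet_derivative f (at x within S) v))"

definition smooth_on :: "'a::euclidean_space set \<Rightarrow> ('a \<Rightarrow> 'b::real_normed_vector) \<Rightarrow> bool" where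
  "smooth_on S f \<longleftrightarrow> (\<forall>k. C_k_on k S f)"

(* F1 i and F2 i j are the first and second order partial derivatives of F with respect to
   the components of u; continuity is joint in (x, u). *)
definition continuous_second_partials_in_input ::
    "((real^'n) \<times> (real^'m) \<Rightarrow> real^'n) \<Rightarrow> bool" where
  "continuous_second_partials_in_input F \<longleftrightarrow>
     (\<exists>F1 F2. \<forall>i j.
        (\<forall>x u. ((\<lambda>s. F (x, u + s *\<^sub>R axis i 1)) has_vector_derivative F1 i (x, u)) (at 0)) \<and>
        (\<forall>x u. ((\<lambda>s. F1 i (x, u + s *\<^sub>R axis j 1)) has_vector_derivative F2 i j (x, u)) (at 0)) \<and>
        continuous_on UNIV (F2 i j))"

definition gradient :: "(real^'n \<Rightarrow> real) \<Rightarrow> real^'n \<Rightarrow> real^'n" where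
  "gradient V x = (\<chi> i. frechet_derivative V (at x) (axis i 1))"

definition lie :: "(real^'n \<Rightarrow> real^'n) \<Rightarrow> (real^'n \<Rightarrow> real) \<Rightarrow> real^'n \<Rightarrow> real" where
  "lie f V x = gradient V x \<bullet> f x"

definition lie_matrix :: "(real^'n \<Rightarrow> real^'m^'n) \<Rightarrow> (real^'n \<Rightarrow> real) \<Rightarrow> real^'n \<Rightarrow> real^'m" where
  "lie_matrix g V x = gradient V x v* g x"

definition positive_definite :: "(real^'n \<Rightarrow> real) \<Rightarrow> bool" where
  "positive_definite V \<longleftrightarrow> V 0 = 0 \<and> (\<forall>x. x \<noteq> 0 \<longrightarrow> 0 < V x)"

definition radially_unbounded :: "(real^'n \<Rightarrow> real) \<Rightarrow> bool" where
  "radially_unbounded V \<longleftrightarrow> filterlim V at_top at_infinity"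

(* Comparison functions are total functions whose values at negative arguments are irrelevant. *)
definition class_K :: "(real \<Rightarrow> real) \<Rightarrow> bool" where
  "class_K \<alpha> \<longleftrightarrow> continuous_on {0..} \<alpha> \<and> strict_mono_on {0..} \<alpha> \<and> \<alpha> 0 = 0"

definition class_K_inf :: "(real \<Rightarrow> real) \<Rightarrow> bool" where
  "class_K_inf \<alpha> \<longleftrightarrow> class_K \<alpha> \<and> filterlim \<alpha> at_top at_top"

definition class_KL :: "(real \<Rightarrow> real \<Rightarrow> real) \<Rightarrow> bool" where
  "class_KL \<beta> \<longleftrightarrow>
     continuous_on ({0..} \<times> {0..}) (\<lambda>(s, t). \<beta> s t) \<and>
     (\<forall>t\<ge>0. class_K (\<lambda>s. \<beta> s t)) \<and>
     (\<forall>s\<ge>0. antimono_on {0..} (\<beta> s) \<and> (\<beta> s \<longlongrightarrow> 0) at_top)"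

definition locally_ess_bounded :: "(real \<Rightarrow> real^'m) \<Rightarrow> bool" where
  "locally_ess_bounded d \<longleftrightarrow>
     d \<in> borel_measurable (lebesgue_on {0..}) \<and>
     (\<forall>T\<ge>0. \<exists>M. AE t in lebesgue_on {0..T}. norm (d t) \<le> M)"

(* Caratheodory solution: for an interval I in {0..} containing 0, the integral equation says
   that x is locally absolutely continuous on I and satisfies the differential equation
   almost everywhere. *)
definition trajectory_on ::
    "real set \<Rightarrow> (real^'n \<Rightarrow> real^'m \<Rightarrow> real^'n) \<Rightarrow> (real \<Rightarrow> real^'m) \<Rightarrow> (real \<Rightarrow> real^'n) \<Rightarrow> bool" where
  "trajectory_on I \<Phi> d x \<longleftrightarrow>
     (\<forall>t\<in>I. (\<lambda>s. \<Phi> (x s) (d s)) absolutely_integrable_on {0..t} \<and>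
            x t = x 0 + integral {0..t} (\<lambda>s. \<Phi> (x s) (d s)))"

(* Trajectories on all initial intervals of {0..} are covered, not only those defined on {0..},
   so that the estimate also excludes finite escape times. *)
definition iISS :: "(real^'n \<Rightarrow> real^'m \<Rightarrow> real^'n) \<Rightarrow> bool" where
  "iISS \<Phi> \<longleftrightarrow>
     (\<exists>\<beta> \<alpha> \<gamma>. class_KL \<beta> \<and> class_K_inf \<alpha> \<and> class_K_inf \<gamma> \<and>
        (\<forall>d I x. locally_ess_bounded d \<and> is_interval I \<and> 0 \<in> I \<and> I \<subseteq> {0..} \<and>
                 trajectory_on I \<Phi> d x \<longrightarrow>
           (\<forall>t\<in>I. \<alpha> (norm (x t)) \<le>
                    \<beta> (norm (x 0)) t + integral {0..t} (\<lambda>s. \<gamma> (norm (d s))))))"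

definition iISS_CLF :: "(real^'n \<Rightarrow> real^'m \<Rightarrow> real^'n) \<Rightarrow> (real^'n \<Rightarrow> real) \<Rightarrow> bool" where
  "iISS_CLF \<Phi> W \<longleftrightarrow>
     positive_definite W \<and> radially_unbounded W \<and> W differentiable_on UNIV \<and>
     (\<exists>\<alpha>\<^sub>5 \<sigma>. continuous_on {0..} \<alpha>\<^sub>5 \<and> \<alpha>\<^sub>5 0 = 0 \<and> (\<forall>s>0. 0 < \<alpha>\<^sub>5 s) \<and> class_K \<sigma> \<and>
        (\<forall>x d. gradient W x \<bullet> \<Phi> x d \<le> - \<alpha>\<^sub>5 (norm x) + \<sigma> (norm d)))"

end

theory Submission
  imports Defs "HOL-Computational_Algebra.Polynomial"
begin

text \<open>Take \<open>\<xi> = \<epsilon> / \<D>\<close>. With \<open>Z = L\<^sub>G V\<close>, the derivative of \<open>U\<close> along the undisturbed closed loop is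
  \<open>- (1 + \<delta>' Z) A + \<delta> B\<close>, where \<open>A = \<xi> |L\<^sub>g V|\<^sup>2 - L\<^sub>f V \<ge> 0\<close> and (A2) says that \<open>B < 0\<close> wherever
  \<open>A = 0\<close> off the origin. On each compact band \<open>1/(k+1) \<le> V \<le> k+1\<close> this is negative as soon as
  \<open>\<delta>\<close> and \<open>|\<delta>'|\<close> are below some constant \<open>c\<^sub>k > 0\<close>, and a rapidly convergent series of bump functions
  meets all these constraints at once. Dividing by \<open>\<D>(2U) + 1\<close> makes the disturbance gain bounded,
  because \<open>V \<le> 2U\<close>.

  For the iISS estimate let \<open>w(t)\<close> be the value of the CLF along a trajectory, \<open>z(t)\<close> the integral of the
  gain and \<open>y = w - z\<close>, which is nonincreasing. Either \<open>y(T) \<le> z(T)\<close>, so \<open>w(T) \<le> 2 z(T)\<close>, or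
  \<open>y(T) \<le> w \<le> 2 y(0)\<close> on all of \<open>[0, T]\<close>. In the second case, bounding the decay rate from below by
  \<open>P(w) q(w)\<close> with \<open>P\<close> nondecreasing and nonexpansive and \<open>q > 0\<close> nonincreasing gives
  \<open>P(y(T)) (1 + T q(2 y(0))) \<le> y(0)\<close>, an explicit \<open>KL\<close> bound.\<close>

section \<open>Calculus of C^k functions\<close>

text \<open>A condition sufficient for derivatives within \<open>S\<close> to be unique: from each
  point, arbitrarily short nonzero steps along every axis stay in \<open>S\<close>. It treats the
  whole space and the half-line, with one-sided derivatives at 0, uniformly.\<close>

definition thick :: "'a::euclidean_space set \<Rightarrow> bool" where
  "thick S \<longleftrightarrow> (\<forall>x\<in>S. \<forall>i\<in>Basis. \<forall>e>0. \<exists>d. 0 < \<bar>d\<bar> \<and> \<bar>d\<bar> < e \<and> x + d *\<^sub>R i \<in> S)"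

lemma thick_UNIV: "thick UNIV"
proof -
  have "\<exists>d. 0 < \<bar>d\<bar> \<and> \<bar>d\<bar> < e" if "0 < e" for e :: real
    using that by (intro exI[of _ "e/2"]) auto
  then show ?thesis unfolding thick_def by auto
qed

lemma thick_Ici: "thick {0::real..}"
proof -
  have "\<exists>d. 0 < \<bar>d\<bar> \<and> \<bar>d\<bar> < e \<and> 0 \<le> x + d" if "0 \<le> x" "0 < e" for x e :: real
    using that by (intro exI[of _ "e/2"]) auto
  then show ?thesis unfolding thick_def by auto
qed

lemma frechet_derivative_thick:
  assumes "thick S" "x \<in> S" "(f has_derivative D) (at x within S)"
  shows "frechet_derivative f (at x within S) = D"
proof -
  have "(f has_derivative frechet_derivative f (at x within S)) (at x within S)"
    using assms(3) frechet_derivative_works differentiableI by blast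
  then show ?thesis
    using frechet_derivative_unique_within[OF _ assms(3)] assms(1,2) unfolding thick_def by blast
qed

lemma has_derivative_frechet:
  assumes "f differentiable_on S" "x \<in> S"
  shows "(f has_derivative frechet_derivative f (at x within S)) (at x within S)"
  using assms frechet_derivative_works unfolding differentiable_on_def by blast

lemma C_k_on_cong:
  assumes "thick S" "\<And>x. x \<in> S \<Longrightarrow> f x = g x" "C_k_on k S f"
  shows "C_k_on k S g"
  using assms(2,3)
proof (induction k arbitrary: f g)
  case 0
  then show ?case using continuous_on_cong[of S S f g] by simp
next
  case (Suc k)
  have D: "(g has_derivative frechet_derivative f (at x within S)) (at x within S)" if "x \<in> S" for x
    by (rule has_derivative_transform[OF that, of g f])
      (use Suc.prems has_derivative_frechet[of f S x] that in auto)
  have "g differentiable_on S" using D unfolding differentiable_on_def differentiable_def by blast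
  moreover have "C_k_on k S (\<lambda>x. frechet_derivative g (at x within S) v)" for v
    by (rule Suc.IH[of "\<lambda>x. frechet_derivative f (at x within S) v"])
      (use Suc.prems frechet_derivative_thick[OF assms(1) _ D] in auto)
  ultimately show ?case by simp
qed

text \<open>Lets an explicit derivative formula, valid only on \<open>S\<close>, stand in for the
  chosen \<open>frechet_derivative\<close>; the closure rules below go through it.\<close>

lemma C_k_on_SucI:
  assumes "thick S" "\<And>x. x \<in> S \<Longrightarrow> (f has_derivative D x) (at x within S)"
    "\<And>v. C_k_on k S (\<lambda>x. D x v)"
  shows "C_k_on (Suc k) S f"
proof -
  have "f differentiable_on S" using assms(2) unfolding differentiable_on_def differentiable_def by blast
  moreover have "C_k_on k S (\<lambda>x. frechet_derivative f (at x within S) v)" for v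
    by (rule C_k_on_cong[OF assms(1) _ assms(3)[of v]])
      (simp add: frechet_derivative_thick[OF assms(1) _ assms(2)])
  ultimately show ?thesis by simp
qed

lemma C_k_on_SucD: "C_k_on (Suc k) S f \<Longrightarrow> C_k_on k S f"
proof (induction k arbitrary: f)
  case 0
  then show ?case by (simp add: differentiable_imp_continuous_on)
next
  case (Suc k)
  have "C_k_on k S (\<lambda>x. frechet_derivative f (at x within S) v)" for v
    using Suc.prems by (intro Suc.IH) simp
  then show ?case using Suc.prems by simp
qed

lemma C_k_on_const:
  assumes "thick S"
  shows "C_k_on k S (\<lambda>x. c)"
proof (induction k arbitrary: c)
  case (Suc k)
  show ?case
    by (rule C_k_on_SucI[OF assms, where D = "\<lambda>x v. 0"]) (simp_all add: Suc)
qed simp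

lemma C_k_on_bounded_linear:
  assumes "thick S" "bounded_linear h"
  shows "C_k_on k S h"
proof (cases k)
  case (Suc j)
  show ?thesis unfolding Suc
    by (rule C_k_on_SucI[OF assms(1), where D = "\<lambda>x. h"])
      (auto intro: bounded_linear_imp_has_derivative assms C_k_on_const)
qed (use assms in \<open>simp add: linear_continuous_on\<close>)

lemma C_k_on_add:
  assumes "thick S" "C_k_on k S f" "C_k_on k S g"
  shows "C_k_on k S (\<lambda>x. f x + g x)"
  using assms(2,3)
proof (induction k arbitrary: f g)
  case (Suc k)
  have "((\<lambda>x. f x + g x) has_derivative
      (\<lambda>v. frechet_derivative f (at x within S) v + frechet_derivative g (at x within S) v)) (at x within S)"
    if "x \<in> S" for x
    using Suc.prems that by (intro has_derivative_add has_derivative_frechet) auto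
  moreover have "C_k_on k S (\<lambda>x. frechet_derivative f (at x within S) v + frechet_derivative g (at x within S) v)" for v
    using Suc.prems by (intro Suc.IH) auto
  ultimately show ?case by (rule C_k_on_SucI[OF assms(1)])
qed (simp add: continuous_on_add)

lemma C_k_on_mult:
  fixes f g :: "'a::euclidean_space \<Rightarrow> real"
  assumes "thick S" "C_k_on k S f" "C_k_on k S g"
  shows "C_k_on k S (\<lambda>x. f x * g x)"
  using assms(2,3)
proof (induction k arbitrary: f g)
  case (Suc k)
  have "((\<lambda>x. f x * g x) has_derivative
      (\<lambda>v. f x * frechet_derivative g (at x within S) v + frechet_derivative f (at x within S) v * g x)) (at x within S)"
    if "x \<in> S" for x
    using Suc.prems that by (intro has_derivative_mult has_derivative_frechet) auto
  moreover have "C_k_on k S (\<lambda>x. f x * frechet_derivative g (at x within S) v + frechet_derivative f (at x within S) v * g x)" for v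
    using Suc.prems C_k_on_SucD[OF Suc.prems(1)] C_k_on_SucD[OF Suc.prems(2)]
    by (intro C_k_on_add[OF assms(1)] Suc.IH) auto
  ultimately show ?case by (rule C_k_on_SucI[OF assms(1)])
qed (simp add: continuous_on_mult)

text \<open>Chain rule by induction on \<open>k\<close>, with \<open>h\<close> varying because the
  derivative contains \<open>h'\<close> at \<open>u x\<close>. The outer domain \<open>T\<close> is
  separate so that functions controlled only on the half-line can be composed with nonnegative
  ones.\<close>

lemma C_k_on_compose:
  fixes h :: "real \<Rightarrow> real" and u :: "'a::euclidean_space \<Rightarrow> real"
  assumes "thick S" "thick T" "\<And>x. x \<in> S \<Longrightarrow> u x \<in> T" "C_k_on k T h" "C_k_on k S u"
  shows "C_k_on k S (\<lambda>x. h (u x))"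
  using assms(4,5)
proof (induction k arbitrary: h)
  case 0
  then show ?case using assms(3) continuous_on_compose2[of T h S u] by auto
next
  case (Suc k)
  define h' where "h' y = frechet_derivative h (at y within T) 1" for y
  define u' where "u' x = frechet_derivative u (at x within S)" for x
  have h': "(h has_derivative (\<lambda>v. v * h' y)) (at y within T)" if "y \<in> T" for y
  proof -
    have *: "(h has_derivative frechet_derivative h (at y within T)) (at y within T)"
      using Suc.prems that has_derivative_frechet by auto
    have "frechet_derivative h (at y within T) v = v * h' y" for v
      using linear_cmul[OF has_derivative_linear[OF *], of v 1] by (simp add: h'_def)
    then have "frechet_derivative h (at y within T) = (\<lambda>v. v * h' y)" by blast
    then show ?thesis using * by simp
  qed
  have "((\<lambda>x. h (u x)) has_derivative (\<lambda>v. u' x v * h' (u x))) (at x within S)" if "x \<in> S" for x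
    by (rule has_derivative_in_compose2[where t = T, OF h'])
      (use assms(3) that Suc.prems has_derivative_frechet[of u S x] in \<open>auto simp: u'_def\<close>)
  moreover have "C_k_on k S (\<lambda>x. u' x v * h' (u x))" for v
    using Suc.IH[of h'] Suc.prems C_k_on_SucD[of k S u]
    by (intro C_k_on_mult assms) (auto simp: u'_def h'_def[abs_def])
  ultimately show ?case by (rule C_k_on_SucI[OF assms(1)])
qed

text \<open>The derivative of the reciprocal contains the reciprocal again, but needed one order
  lower, which the induction hypothesis supplies.\<close>

lemma C_k_on_inverse:
  fixes f :: "'a::euclidean_space \<Rightarrow> real"
  assumes "thick S" "\<And>x. x \<in> S \<Longrightarrow> f x \<noteq> 0" "C_k_on k S f"
  shows "C_k_on k S (\<lambda>x. inverse (f x))"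
  using assms(3)
proof (induction k)
  case 0
  then show ?case using assms(2) by (simp add: continuous_on_inverse)
next
  case (Suc k)
  define f' where "f' x = frechet_derivative f (at x within S)" for x
  have "((\<lambda>x. inverse (f x)) has_derivative (\<lambda>v. - (inverse (f x) * f' x v * inverse (f x)))) (at x within S)"
    if "x \<in> S" for x
    using Suc.prems that assms(2) has_derivative_frechet[of f S x]
    by (intro Deriv.has_derivative_inverse) (auto simp: f'_def)
  moreover have "C_k_on k S (\<lambda>x. - (inverse (f x) * f' x v * inverse (f x)))" for v
  proof -
    have "C_k_on k S (\<lambda>x. (-1) * (inverse (f x) * f' x v * inverse (f x)))"
      using Suc.IH Suc.prems C_k_on_SucD[of k S f]
      by (intro C_k_on_mult assms C_k_on_const) (auto simp: f'_def)
    then show ?thesis by simp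
  qed
  ultimately show ?case by (rule C_k_on_SucI[OF assms(1)])
qed

lemma smooth_on_antiderivative:
  fixes h :: "real \<Rightarrow> real"
  assumes "thick S" "smooth_on S h" "\<And>x. x \<in> S \<Longrightarrow> (H has_real_derivative h x) (at x within S)"
  shows "smooth_on S H"
proof -
  have H: "C_k_on (Suc k) S H" for k
    by (rule C_k_on_SucI[OF assms(1), where D = "\<lambda>x v. h x * v"])
      (use assms in \<open>auto simp: smooth_on_def has_field_derivative_def intro!: C_k_on_mult C_k_on_const\<close>)
  then show ?thesis unfolding smooth_on_def using C_k_on_SucD[OF H] by blast
qed

text \<open>Induction on \<open>k\<close> for all \<open>j\<close> at once. This form suits
  functions whose derivatives are known in closed form or as series.\<close>

lemma smooth_on_derivative_sequence:
  fixes D :: "nat \<Rightarrow> real \<Rightarrow> real"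
  assumes "thick S" "\<And>j x. x \<in> S \<Longrightarrow> (D j has_real_derivative D (Suc j) x) (at x within S)"
  shows "smooth_on S (D j)"
proof -
  have "C_k_on k S (D j)" for k
  proof (induction k arbitrary: j)
    case 0
    then show ?case using assms(2) by (auto intro: DERIV_continuous_on)
  next
    case (Suc k)
    show ?case
      by (rule C_k_on_SucI[OF assms(1), where D = "\<lambda>x v. D (Suc j) x * v"])
        (use assms Suc in \<open>auto simp: has_field_derivative_def intro!: C_k_on_mult C_k_on_const\<close>)
  qed
  then show ?thesis by (simp add: smooth_on_def)
qed

lemma derivative_sequence_of_smooth:
  fixes h :: "real \<Rightarrow> real"
  assumes "smooth_on UNIV h"
  obtains D :: "nat \<Rightarrow> real \<Rightarrow> real"
  where "D 0 = h" "\<And>j x. (D j has_real_derivative D (Suc j) x) (at x)"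
proof -
  define D where "D = rec_nat h (\<lambda>_ f x. frechet_derivative f (at x) 1)"
  have D0: "D 0 = h" and DS: "D (Suc j) = (\<lambda>x. frechet_derivative (D j) (at x) 1)" for j
    by (simp_all add: D_def)
  have "smooth_on UNIV (D j)" for j
  proof (induction j)
    case (Suc j)
    show ?case unfolding smooth_on_def
    proof
      fix k
      have "C_k_on (Suc k) UNIV (D j)" using Suc unfolding smooth_on_def by blast
      then show "C_k_on k UNIV (D (Suc j))" unfolding DS by simp
    qed
  qed (use assms D0 in simp)
  then have diff: "D j differentiable (at x)" for j x
  proof -
    have "C_k_on (Suc 0) UNIV (D j)" using \<open>\<And>j. smooth_on UNIV (D j)\<close> unfolding smooth_on_def by blast
    then show ?thesis by (simp add: differentiable_on_def)
  qed
  have "(D j has_real_derivative D (Suc j) x) (at x)" for j x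
  proof -
    have *: "(D j has_derivative frechet_derivative (D j) (at x)) (at x)"
      using diff frechet_derivative_works by blast
    have "frechet_derivative (D j) (at x) v = D (Suc j) x * v" for v
      using linear_cmul[OF has_derivative_linear[OF *], of v 1] by (simp add: DS)
    then have "frechet_derivative (D j) (at x) = (\<lambda>v. D (Suc j) x * v)" by blast
    then show ?thesis using * by (simp add: has_field_derivative_def)
  qed
  then show ?thesis using that D0 by blast
qed

section \<open>Small smooth functions\<close>

text \<open>Generalizes the classical flat function exp(-1/t), extended by 0 to the left: the
  polynomial factor in 1/t makes the family closed under differentiation.\<close>

definition flat_exp :: "real poly \<Rightarrow> real \<Rightarrow> real" where
  "flat_exp p t = (if 0 < t then poly p (1 / t) * exp (- (1 / t)) else 0)"

lemma poly_times_exp_neg_tendsto_0: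
  fixes p :: "real poly"
  shows "((\<lambda>y. poly p y * exp (- y)) \<longlongrightarrow> 0) at_top"
proof -
  have "((\<lambda>y. \<Sum>i\<le>degree p. coeff p i * (y ^ i / exp y)) \<longlongrightarrow> (\<Sum>i\<le>degree p. coeff p i * 0)) at_top"
    by (intro tendsto_intros tendsto_power_div_exp_0)
  moreover have "(\<Sum>i\<le>degree p. coeff p i * (y ^ i / exp y)) = poly p y * exp (- y)" for y
    by (simp add: poly_altdef sum_distrib_right exp_minus divide_inverse mult.assoc)
  ultimately show ?thesis by simp
qed

text \<open>With y = 1/t one has dy/dt = -y^2, so p(y) exp(-y) has derivative y^2 (p(y) - p'(y))
  exp(-y); each \<open>pCons 0\<close> multiplies by y.\<close>

lemma flat_exp_has_derivative:
  "(flat_exp p has_real_derivative flat_exp (pCons 0 (pCons 0 (p - pderiv p))) t) (at t)"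
proof -
  consider "t < 0" | "t = 0" | "0 < t" by linarith
  then show ?thesis
  proof cases
    case 1
    have "((\<lambda>t. 0) has_real_derivative 0) (at t)" by simp
    then have "(flat_exp p has_real_derivative 0) (at t)"
      by (rule has_field_derivative_transform_within_open[where S = "{..<0}"])
        (use 1 in \<open>auto simp: flat_exp_def\<close>)
    then show ?thesis using 1 by (simp add: flat_exp_def)
  next
    case 2
    \<comment> \<open>The quotient is 0 on the left; on the right the substitution y = 1/h turns it
      into y p(y) exp(-y), which tends to 0.\<close>
    have "((\<lambda>h. flat_exp p h / h) \<longlongrightarrow> 0) (at 0)"
      unfolding filterlim_at_split
    proof
      have "\<forall>\<^sub>F h in at_left 0. flat_exp p h / h = 0"
        unfolding eventually_at_left_field by (auto simp: flat_exp_def intro!: exI[of _ "-1"])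
      then show "((\<lambda>h. flat_exp p h / h) \<longlongrightarrow> 0) (at_left 0)" by (rule tendsto_eventually)
      have "\<forall>\<^sub>F y in at_top. poly (pCons 0 p) y * exp (- y) = flat_exp p (inverse y) / inverse y"
        using eventually_gt_at_top[of 0]
        by eventually_elim (auto simp: flat_exp_def field_simps)
      from Lim_transform_eventually[OF poly_times_exp_neg_tendsto_0 this]
      show "((\<lambda>h. flat_exp p h / h) \<longlongrightarrow> 0) (at_right 0)"
        unfolding filterlim_at_right_to_top .
    qed
    then show ?thesis using 2 unfolding DERIV_def by (simp add: flat_exp_def)
  next
    case 3
    have "((\<lambda>t. poly p (1 / t) * exp (- (1 / t))) has_real_derivative
        poly (pderiv p) (1 / t) * (- 1 / t\<^sup>2) * exp (- (1 / t)) + poly p (1 / t) * (exp (- (1 / t)) * (1 / t\<^sup>2))) (at t)"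
      using 3 by (auto intro!: derivative_eq_intros DERIV_chain2[OF poly_DERIV] simp: power2_eq_square field_simps)
    then have "(flat_exp p has_real_derivative
        poly (pderiv p) (1 / t) * (- 1 / t\<^sup>2) * exp (- (1 / t)) + poly p (1 / t) * (exp (- (1 / t)) * (1 / t\<^sup>2))) (at t)"
      by (rule has_field_derivative_transform_within_open[where S = "{0<..}"])
        (use 3 in \<open>auto simp: flat_exp_def\<close>)
    moreover have "poly (pderiv p) (1 / t) * (- 1 / t\<^sup>2) * exp (- (1 / t)) + poly p (1 / t) * (exp (- (1 / t)) * (1 / t\<^sup>2))
        = flat_exp (pCons 0 (pCons 0 (p - pderiv p))) t"
      using 3 by (simp add: flat_exp_def power2_eq_square field_simps)
    ultimately show ?thesis by simp
  qed
qed

lemma smooth_flat_exp: "smooth_on UNIV (flat_exp p)"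
proof -
  define D where "D j = flat_exp (((\<lambda>p. pCons 0 (pCons 0 (p - pderiv p))) ^^ j) p)" for j
  have "smooth_on UNIV (D 0)"
    by (rule smooth_on_derivative_sequence[OF thick_UNIV]) (simp add: D_def flat_exp_has_derivative)
  then show ?thesis by (simp add: D_def)
qed

text \<open>A product of two flat functions, one leaving 0 at \<open>a\<close> and one reaching 0 at
  \<open>b\<close>. The whole sequence of derivatives is returned with a bound for each order,
  because a series of bumps will be differentiated termwise.\<close>

lemma bump_function:
  fixes a b :: real
  obtains D :: "nat \<Rightarrow> real \<Rightarrow> real" and B :: "nat \<Rightarrow> real"
  where "\<And>j x. (D j has_real_derivative D (Suc j) x) (at x)"
    "\<And>x. 0 \<le> D 0 x" "\<And>x. a < x \<Longrightarrow> x < b \<Longrightarrow> 0 < D 0 x"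
    "\<And>j x. x \<notin> {a..b} \<Longrightarrow> D j x = 0" "\<And>j x. \<bar>D j x\<bar> \<le> B j"
proof -
  define \<phi> where "\<phi> x = flat_exp 1 (x - a) * flat_exp 1 (b - x)" for x
  have lin: "C_k_on k UNIV (\<lambda>x::real. x + (- a))" "C_k_on k UNIV (\<lambda>x::real. b + - x)" for k
    by (rule C_k_on_add[OF thick_UNIV C_k_on_bounded_linear[OF thick_UNIV bounded_linear_ident] C_k_on_const[OF thick_UNIV]])
      (rule C_k_on_add[OF thick_UNIV C_k_on_const[OF thick_UNIV]
          C_k_on_bounded_linear[OF thick_UNIV bounded_linear_minus[OF bounded_linear_ident]]])
  have flat: "C_k_on k UNIV (flat_exp 1)" for k
    using smooth_flat_exp unfolding smooth_on_def by blast
  have \<phi>_smooth: "smooth_on UNIV \<phi>"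
    unfolding \<phi>_def[abs_def] smooth_on_def
    using C_k_on_mult[OF thick_UNIV C_k_on_compose[OF thick_UNIV thick_UNIV UNIV_I flat lin(1)]
        C_k_on_compose[OF thick_UNIV thick_UNIV UNIV_I flat lin(2)]]
    by simp
  obtain D :: "nat \<Rightarrow> real \<Rightarrow> real"
    where D0: "D 0 = \<phi>" and D: "\<And>j x. (D j has_real_derivative D (Suc j) x) (at x)"
    using derivative_sequence_of_smooth[OF \<phi>_smooth] by blast
  have out: "D j x = 0" if "x \<notin> {a..b}" for j x
    using that
  proof (induction j arbitrary: x)
    case 0
    then show ?case by (auto simp: D0 \<phi>_def flat_exp_def)
  next
    case (Suc j)
    have "((\<lambda>x. 0) has_real_derivative 0) (at x)" by simp
    then have "(D j has_real_derivative 0) (at x)"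
      by (rule has_field_derivative_transform_within_open[where S = "- {a..b}"])
        (use Suc in \<open>auto intro: open_Compl\<close>)
    then show ?case using D DERIV_unique by blast
  qed
  have "\<exists>B. \<forall>x. \<bar>D j x\<bar> \<le> B" for j
  proof -
    have "compact (D j ` {a..b})"
      using D by (intro compact_continuous_image) (auto intro: DERIV_continuous_on has_field_derivative_at_within)
    then obtain B where "\<forall>x\<in>{a..b}. \<bar>D j x\<bar> \<le> B"
      using compact_imp_bounded bounded_iff by (metis imageI real_norm_def)
    then have "\<bar>D j x\<bar> \<le> max 0 B" for x using out[of x j] by (cases "x \<in> {a..b}") (auto intro: max.coboundedI2)
    then show ?thesis by blast
  qed
  then obtain B where "\<And>j x. \<bar>D j x\<bar> \<le> B j" by metis
  moreover have "0 \<le> D 0 x" "a < x \<Longrightarrow> x < b \<Longrightarrow> 0 < D 0 x" for x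
    by (auto simp: D0 \<phi>_def flat_exp_def)
  ultimately show ?thesis using that D out by blast
qed

text \<open>The weights decay so fast that every formal derivative of the series of bumps converges
  uniformly.\<close>
lemma small_smooth_function:
  fixes c :: "nat \<Rightarrow> real"
  assumes c_pos: "\<And>k. 0 < c k"
  obtains \<delta> \<delta>' :: "real \<Rightarrow> real"
  where "smooth_on {0..} \<delta>" "\<And>v. (\<delta> has_real_derivative \<delta>' v) (at v)" "continuous_on UNIV \<delta>'"
    "\<delta> 0 = 0" "\<And>v. 0 \<le> \<delta> v" "\<And>v. 0 < v \<Longrightarrow> 0 < \<delta> v"
    "\<And>v. 0 < v \<Longrightarrow> \<exists>k. v \<in> {1 / (real k + 1)..real k + 1} \<and> \<delta> v \<le> c k \<and> \<bar>\<delta>' v\<bar> \<le> c k"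
proof -
  \<comment> \<open>Bundles the bump properties so that a single choice over \<open>k\<close> yields
    bumps and derivative bounds together.\<close>
  define good where "good k D B \<longleftrightarrow> (\<forall>j x. (D j has_real_derivative D (Suc j) x) (at x)) \<and>
    (\<forall>x. 0 \<le> D 0 x) \<and> (\<forall>x. 1 / (real k + 1) < x \<and> x < real k + 1 \<longrightarrow> 0 < D 0 x) \<and>
    (\<forall>j x. x \<notin> {1 / (real k + 1)..real k + 1} \<longrightarrow> D j x = 0) \<and> (\<forall>j x. \<bar>D j x\<bar> \<le> B j)"
    for k :: nat and D :: "nat \<Rightarrow> real \<Rightarrow> real" and B :: "nat \<Rightarrow> real"
  have "\<exists>D B. good k D B" for k
    by (rule bump_function[of "1 / (real k + 1)" "real k + 1"]) (unfold good_def, blast)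
  then obtain \<phi> B where "\<And>k. good k (\<phi> k) (B k)" by metis
  then have \<phi>: "\<And>k j x. (\<phi> k j has_real_derivative \<phi> k (Suc j) x) (at x)"
    "\<And>k x. 0 \<le> \<phi> k 0 x" "\<And>k x. 1 / (real k + 1) < x \<Longrightarrow> x < real k + 1 \<Longrightarrow> 0 < \<phi> k 0 x"
    "\<And>k j x. x \<notin> {1 / (real k + 1)..real k + 1} \<Longrightarrow> \<phi> k j x = 0" and B: "\<And>k j x. \<bar>\<phi> k j x\<bar> \<le> B k j"
    unfolding good_def by blast+
  have B0: "0 \<le> B k j" for k j using B[of k j 0] by linarith
  \<comment> \<open>At most every \<open>c i\<close> with \<open>i \<le> k\<close>, so the k-th bump
    respects the constraints of all earlier bands; the cap at 1 serves summability.\<close>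
  define m where "m k = min 1 (Min (c ` {..k}))" for k
  have m: "0 < m k" "m k \<le> 1" "m k \<le> Min (c ` {..k})" for k unfolding m_def using c_pos by auto
  \<comment> \<open>Dividing by the bounds of all orders up to \<open>Suc k\<close> controls each
    fixed order from some index on, and the orders 0 and 1 for every \<open>k\<close>, already at
    \<open>k = 0\<close>.\<close>
  define a where "a k = (1/2) ^ Suc k * m k / (1 + (\<Sum>j\<le>Suc k. B k j))" for k
  have sB: "0 \<le> (\<Sum>j\<le>Suc k. B k j)" for k using B0 by (intro sum_nonneg) auto
  have a0: "0 < a k" for k unfolding a_def using m sB[of k] by (intro divide_pos_pos mult_pos_pos) auto
  have aB: "a k * B k j \<le> (1/2) ^ Suc k * m k" if "j \<le> Suc k" for k j
  proof -
    have "B k j \<le> (\<Sum>j\<le>Suc k. B k j)" using that B0 by (intro member_le_sum) auto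
    then have "B k j / (1 + (\<Sum>j\<le>Suc k. B k j)) \<le> 1" using sB[of k] by (simp add: divide_le_eq)
    then have "(1/2) ^ Suc k * m k * (B k j / (1 + (\<Sum>j\<le>Suc k. B k j))) \<le> (1/2) ^ Suc k * m k * 1"
      using m[of k] by (intro mult_left_mono) auto
    then show ?thesis by (simp add: a_def)
  qed
  have term_le: "\<bar>a k * \<phi> k j x\<bar> \<le> a k * B k j" for k j x
    using B[of k j x] a0[of k] by (simp add: abs_mult)
  \<comment> \<open>The weights control order \<open>j\<close> only for large \<open>k\<close>, so
    the comparison with the geometric series is an eventual one.\<close>
  have summ: "summable (\<lambda>k. a k * B k j)" for j
  proof (rule summable_comparison_test_ev[where g = "\<lambda>k. (1/2) ^ Suc k"])
    have "norm (a k * B k j) \<le> (1/2) ^ Suc k" if "j \<le> k" for k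
    proof -
      have "(1/2) ^ Suc k * m k \<le> (1/2) ^ Suc k * 1" using m[of k] by (intro mult_left_mono) auto
      then have "a k * B k j \<le> (1/2) ^ Suc k" using aB[of j k] that by linarith
      then show ?thesis using B0[of k j] a0[of k] by simp
    qed
    then show "\<forall>\<^sub>F k in sequentially. norm (a k * B k j) \<le> (1/2) ^ Suc k"
      unfolding eventually_sequentially by blast
    show "summable (\<lambda>k. (1/2) ^ Suc k :: real)" by (simp add: summable_geometric)
  qed
  define D where "D j x = (\<Sum>k. a k * \<phi> k j x)" for j x
  have summT: "summable (\<lambda>k. a k * \<phi> k j x)" for j x
    by (rule summable_comparison_test'[OF summ[of j], of 0]) (use term_le in simp)
  have D: "(D j has_real_derivative D (Suc j) x) (at x)" for j x
    unfolding D_def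
  proof (rule has_field_derivative_series'(2)[where S = UNIV and ?x0.0 = 0])
    show "((\<lambda>x. a k * \<phi> k j x) has_field_derivative a k * \<phi> k (Suc j) x) (at x within UNIV)" for k x
      using DERIV_cmult[OF \<phi>(1)] by simp
    show "uniformly_convergent_on UNIV (\<lambda>n x. \<Sum>i<n. a i * \<phi> i (Suc j) x)"
      by (rule Weierstrass_m_test'[OF _ summ[of "Suc j"]]) (use term_le in auto)
  qed (use summT in auto)
  \<comment> \<open>If \<open>J k0\<close> is the first band containing \<open>v\<close>, earlier
    bumps vanish at \<open>v\<close> and later ones have \<open>m k \<le> c k0\<close>. The
    geometric weights sum to 1, so \<open>c k0\<close> bounds value and derivative alike.\<close>
  have small: "\<exists>k. v \<in> {1 / (real k + 1)..real k + 1} \<and> \<bar>D 0 v\<bar> \<le> c k \<and> \<bar>D 1 v\<bar> \<le> c k" if "0 < v" for v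
  proof -
    define J where "J k = {1 / (real k + 1)..real k + 1}" for k :: nat
    obtain k :: nat where k: "max v (1 / v) < real k" using reals_Archimedean2 by blast
    then have "1 < real k * v" using that by (auto simp: field_simps)
    then have "1 / (real k + 1) \<le> v" using that by (simp add: field_simps)
    then have "v \<in> J k" using k by (simp add: J_def)
    define k0 where "k0 = (LEAST k. v \<in> J k)"
    have k0: "v \<in> J k0" "\<And>k. k < k0 \<Longrightarrow> v \<notin> J k"
      unfolding k0_def using LeastI[of "\<lambda>k. v \<in> J k", OF \<open>v \<in> J k\<close>] not_less_Least by blast+
    have "\<bar>D j v\<bar> \<le> c k0" if "j \<le> 1" for j
    proof -
      have *: "norm (a k * \<phi> k j v) \<le> (1/2) ^ Suc k * c k0" for k
      proof (cases "k < k0")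
        case True
        then have "\<phi> k j v = 0" using k0(2) \<phi>(4) by (simp add: J_def)
        then show ?thesis using c_pos[of k0] by simp
      next
        case False
        then have "m k \<le> c k0" using m(3)[of k] by (meson Min_le atMost_iff finite_atMost finite_imageI imageI not_le order_trans)
        then have "(1/2) ^ Suc k * m k \<le> (1/2) ^ Suc k * c k0" by (intro mult_left_mono) auto
        moreover have "a k * B k j \<le> (1/2) ^ Suc k * m k" using aB[of j k] that by simp
        ultimately show ?thesis using term_le[of k j v] unfolding real_norm_def by linarith
      qed
      have "(\<lambda>k. (1/2) ^ Suc k * c k0) sums c k0"
        using sums_mult2[OF power_half_series, of "c k0"] by simp
      then show ?thesis
        unfolding D_def using norm_suminf_le[of "\<lambda>k. a k * \<phi> k j v", OF *] by (simp add: sums_iff)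
    qed
    then show ?thesis using k0(1) J_def by auto
  qed
  show thesis
  proof
    show "smooth_on {0..} (D 0)"
      by (rule smooth_on_derivative_sequence[OF thick_Ici]) (rule has_field_derivative_at_within[OF D])
    show "(D 0 has_real_derivative D 1 v) (at v)" for v using D[of 0] by simp
    show "continuous_on UNIV (D 1)" using D by (intro DERIV_continuous_on) auto
    have "\<phi> k j 0 = 0" for k j by (rule \<phi>(4)) (simp add: divide_le_0_iff)
    then show "D 0 0 = 0" by (simp add: D_def)
    show nonneg: "0 \<le> D 0 v" for v
      unfolding D_def using \<phi>(2) a0 by (intro suminf_nonneg summT mult_nonneg_nonneg) (auto intro: less_imp_le)
    show "0 < D 0 v" if "0 < v" for v
    proof -
      obtain k :: nat where k: "max v (1 / v) < real k" using reals_Archimedean2 by blast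
      then have "1 < real k * v" using that by (auto simp: field_simps)
      then have "1 < (real k + 1) * v" using that by (simp add: algebra_simps)
      then have "1 / (real k + 1) < v" by (simp add: field_simps)
      then have "0 < \<phi> k 0 v" using k by (intro \<phi>(3)) auto
      then show ?thesis
        unfolding D_def using \<phi>(2) a0 by (intro suminf_pos2[where i = k] summT mult_nonneg_nonneg mult_pos_pos) (auto intro: less_imp_le)
    qed
    show "\<exists>k. v \<in> {1 / (real k + 1)..real k + 1} \<and> D 0 v \<le> c k \<and> \<bar>D 1 v\<bar> \<le> c k" if "0 < v" for v
      using small[OF that] by auto
  qed
qed

section \<open>Comparison functions\<close>

text \<open>\<open>P\<close> is an infimal convolution of \<open>r\<close>, seen along
  \<open>w\<close>, with a one-sided cone, which forces monotonicity and slope at most 1. The last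
  property, that \<open>P s\<close> is a greatest lower bound, is the source of positivity and
  growth of \<open>P\<close> later.\<close>

lemma mono_lipschitz_minorant:
  fixes r w :: "'a \<Rightarrow> real"
  assumes "\<And>x. 0 \<le> r x"
  obtains P :: "real \<Rightarrow> real"
  where "\<And>x. P (w x) \<le> r x" "\<And>s t. s \<le> t \<Longrightarrow> P s \<le> P t" "\<And>s t. s \<le> t \<Longrightarrow> P t \<le> P s + (t - s)"
    "\<And>s. 0 \<le> P s" "\<And>s c. \<forall>x. c \<le> r x + max 0 (s - w x) \<Longrightarrow> c \<le> P s"
proof
  define P where "P s = (INF x. r x + max 0 (s - w x))" for s
  have bdd: "bdd_below (range (\<lambda>x. r x + max 0 (s - w x)))" for s
    using assms by (intro bdd_belowI[of _ 0]) (auto intro: add_nonneg_nonneg)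
  have lower: "P s \<le> r x + max 0 (s - w x)" for s x
    unfolding P_def by (rule cINF_lower[OF bdd]) simp
  show greatest: "c \<le> P s" if "\<forall>x. c \<le> r x + max 0 (s - w x)" for s c
    unfolding P_def using that by (intro cINF_greatest) auto
  show "P (w x) \<le> r x" for x using lower[of "w x" x] by simp
  show "0 \<le> P s" for s using assms by (intro greatest) (auto intro: add_nonneg_nonneg)
  show "P s \<le> P t" if "s \<le> t" for s t
  proof (rule greatest, rule)
    show "P s \<le> r x + max 0 (t - w x)" for x using lower[of s x] that by linarith
  qed
  show "P t \<le> P s + (t - s)" if "s \<le> t" for s t
  proof -
    have "P t - (t - s) \<le> r x + max 0 (s - w x)" for x using lower[of t x] that by linarith
    then have "P t - (t - s) \<le> P s" by (intro greatest allI)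
    then show ?thesis by simp
  qed
qed

lemma continuous_on_nonexpansive_mono:
  fixes P :: "real \<Rightarrow> real"
  assumes "\<And>s t. s \<le> t \<Longrightarrow> P s \<le> P t" "\<And>s t. s \<le> t \<Longrightarrow> P t \<le> P s + (t - s)"
  shows "continuous_on S P"
proof -
  have "\<bar>P s - P t\<bar> \<le> \<bar>s - t\<bar>" for s t
    using assms[of s t] assms[of t s] by (cases "s \<le> t") auto
  then show ?thesis
    unfolding continuous_on_iff dist_real_def by (metis le_less_trans)
qed

lemma compact_level_band:
  fixes W :: "'a::euclidean_space \<Rightarrow> real"
  assumes "continuous_on UNIV W" "filterlim W at_top at_infinity"
  shows "compact {x. a \<le> W x \<and> W x \<le> b}"
proof -
  obtain r where r: "\<And>x. r \<le> norm x \<Longrightarrow> b + 1 \<le> W x"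
    using assms(2) unfolding filterlim_at_top eventually_at_infinity by blast
  have "bounded {x. a \<le> W x \<and> W x \<le> b}"
  proof (rule boundedI[of _ r])
    show "norm x \<le> r" if "x \<in> {x. a \<le> W x \<and> W x \<le> b}" for x
      using r[of x] that by (cases "r \<le> norm x") auto
  qed
  moreover have "closed {x. a \<le> W x \<and> W x \<le> b}"
    using assms(1) by (intro closed_Collect_conj closed_Collect_le) auto
  ultimately show ?thesis using compact_eq_bounded_closed by blast
qed

lemma compact_positive_lower_bound:
  fixes h :: "'a::topological_space \<Rightarrow> real"
  assumes "compact C" "continuous_on C h" "\<And>x. x \<in> C \<Longrightarrow> 0 < h x"
  shows "\<exists>c>0. \<forall>x\<in>C. c \<le> h x"
proof (cases "C = {}")
  case False
  then obtain x where "x \<in> C" "\<forall>y\<in>C. h x \<le> h y"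
    using continuous_attains_inf assms by blast
  then show ?thesis using assms(3) by blast
qed (auto intro: exI[of _ 1])

text \<open>The minorant \<open>P\<close> along \<open>norm\<close> is continuous, nondecreasing and
  unbounded, but perhaps not strictly increasing; the factor s/(1+s) repairs this without raising
  it.\<close>

lemma class_K_inf_minorant:
  fixes h :: "'a::euclidean_space \<Rightarrow> real"
  assumes "continuous_on UNIV h" "h 0 = 0" "\<And>x. x \<noteq> 0 \<Longrightarrow> 0 < h x" "filterlim h at_top at_infinity"
  obtains \<alpha> where "class_K_inf \<alpha>" "\<And>x. \<alpha> (norm x) \<le> h x"
proof -
  have h0: "0 \<le> h x" for x using assms(2) assms(3)[of x] by (cases "x = 0") auto
  obtain P where P: "\<And>x. P (norm x) \<le> h x" "\<And>s t. s \<le> t \<Longrightarrow> P s \<le> P t"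
      "\<And>s t. s \<le> t \<Longrightarrow> P t \<le> P s + (t - s)" "\<And>s. 0 \<le> P s"
      "\<And>s c. \<forall>x. c \<le> h x + max 0 (s - norm x) \<Longrightarrow> c \<le> P s"
    using mono_lipschitz_minorant[where r = h and w = norm, OF h0] by metis
  have large: "\<exists>b. \<forall>s\<ge>b. M \<le> P s" for M
  proof -
    obtain b where b: "\<And>x. b \<le> norm x \<Longrightarrow> M \<le> h x"
      using assms(4) unfolding filterlim_at_top eventually_at_infinity by blast
    \<comment> \<open>Either \<open>norm x\<close> is at least \<open>b\<close>, where
      \<open>h x\<close> is at least \<open>M\<close>, or the cone term alone exceeds
      \<open>M\<close>.\<close>
    have "M \<le> P s" if "b + max 0 M \<le> s" for s
    proof (rule P(5), rule)
      show "M \<le> h x + max 0 (s - norm x)" for x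
        using b[of x] h0[of x] that by (cases "b \<le> norm x") auto
    qed
    then show ?thesis by blast
  qed
  have pos: "0 < P s" if "0 < s" for s
  proof -
    obtain b where b: "\<And>x. b \<le> norm x \<Longrightarrow> 1 \<le> h x"
      using assms(4) unfolding filterlim_at_top eventually_at_infinity by blast
    have "\<exists>c>0. \<forall>x\<in>{x. s/2 \<le> norm x \<and> norm x \<le> b}. c \<le> h x"
    proof (intro compact_positive_lower_bound compact_level_band filterlim_norm_at_top continuous_on_norm_id)
      show "0 < h x" if "x \<in> {x. s/2 \<le> norm x \<and> norm x \<le> b}" for x
        using that \<open>0 < s\<close> by (intro assms(3)) auto
    qed (use continuous_on_subset[OF assms(1)] in auto)
    then obtain c where c: "0 < c" "\<And>x. s/2 \<le> norm x \<Longrightarrow> norm x \<le> b \<Longrightarrow> c \<le> h x" by blast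
    \<comment> \<open>Three zones: within radius s/2 the cone term is at least s/2, on the compact
      shell \<open>h\<close> is at least \<open>c\<close>, and beyond radius \<open>b\<close> it is
      at least 1.\<close>
    have "min (min c 1) (s/2) \<le> P s"
    proof (rule P(5), rule)
      show "min (min c 1) (s/2) \<le> h x + max 0 (s - norm x)" for x
        using c(2)[of x] b[of x] h0[of x] that
        by (cases "s/2 \<le> norm x"; cases "b \<le> norm x") (auto simp: min_le_iff_disj max_def)
    qed
    then show ?thesis using c(1) that by (auto simp: min_le_iff_disj)
  qed
  define \<alpha> where "\<alpha> s = P s * (s / (1 + s))" for s
  have frac: "s / (1 + s) < t / (1 + t)" if "0 \<le> s" "s < t" for s t :: real
    using that by (simp add: divide_less_eq less_divide_eq field_simps)
  have "continuous_on {0..} \<alpha>"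
    unfolding \<alpha>_def[abs_def]
    by (intro continuous_intros continuous_on_nonexpansive_mono[where P = P] P(2,3)) auto
  moreover have "\<alpha> s < \<alpha> t" if "0 \<le> s" "s < t" for s t
  proof -
    have "P s * (s / (1 + s)) \<le> P t * (s / (1 + s))"
      using that P(2)[of s t] by (intro mult_right_mono) auto
    also have "\<dots> < P t * (t / (1 + t))"
      using that pos[of t] by (intro mult_strict_left_mono frac) auto
    finally show ?thesis by (simp add: \<alpha>_def)
  qed
  moreover have "filterlim \<alpha> at_top at_top"
    unfolding filterlim_at_top eventually_at_top_linorder
  proof
    fix M
    obtain b where b: "\<And>s. b \<le> s \<Longrightarrow> 2 * max 0 M \<le> P s" using large by blast
    have "M \<le> \<alpha> s" if "max 1 b \<le> s" for s
    proof -
      have "(2 * max 0 M) * (1 / 2) \<le> P s * (s / (1 + s))"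
        using that b[of s] by (intro mult_mono) (auto simp: field_simps)
      then show ?thesis by (simp add: \<alpha>_def)
    qed
    then show "\<exists>N. \<forall>s\<ge>N. M \<le> \<alpha> s" by blast
  qed
  ultimately have "class_K_inf \<alpha>"
    unfolding class_K_inf_def class_K_def strict_mono_on_def by (simp add: \<alpha>_def)
  moreover have "\<alpha> (norm x) \<le> h x" for x
  proof -
    have "\<alpha> (norm x) \<le> P (norm x) * 1"
      unfolding \<alpha>_def using P(4) by (intro mult_left_mono) (auto simp: divide_le_eq add_pos_nonneg)
    then show ?thesis using P(1)[of x] by linarith
  qed
  ultimately show thesis using that by blast
qed

text \<open>Take the supremum of \<open>h\<close> over the ball of radius \<open>s\<close>, written
  over the fixed unit ball so that continuity in \<open>s\<close> follows from uniform continuity on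
  a compact product; adding \<open>s\<close> makes it strictly increasing.\<close>

lemma class_K_majorant:
  fixes h :: "'a::euclidean_space \<Rightarrow> real"
  assumes cont: "continuous_on UNIV h" and "h 0 = 0"
  obtains \<alpha> where "class_K \<alpha>" "\<And>x. h x \<le> \<alpha> (norm x)"
proof -
  define M where "M s = (SUP u\<in>cball 0 1. h (s *\<^sub>R u))" for s :: real
  have bdd: "bdd_above ((\<lambda>u. h (s *\<^sub>R u)) ` cball 0 1)" for s
  proof -
    have "compact ((\<lambda>u. h (s *\<^sub>R u)) ` cball 0 1)"
      by (intro compact_continuous_image continuous_on_compose2[OF cont] continuous_intros) auto
    then show ?thesis by (intro bounded_imp_bdd_above compact_imp_bounded)
  qed
  have upper: "h (s *\<^sub>R u) \<le> M s" if "norm u \<le> 1" for s u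
    unfolding M_def by (rule cSUP_upper[OF _ bdd]) (use that in simp)
  have least: "M s \<le> c" if "\<And>u. norm u \<le> 1 \<Longrightarrow> h (s *\<^sub>R u) \<le> c" for s c
    unfolding M_def using that by (intro cSUP_least) auto
  have "M 0 = 0" using upper[of 0 0] least[of 0 0] assms(2) by force
  have mono: "M s \<le> M t" if "0 \<le> s" "s \<le> t" for s t
  proof (cases "t = 0")
    case False
    show ?thesis
    proof (rule least)
      fix u :: 'a assume "norm u \<le> 1"
      then have "s * norm u \<le> t" using that mult_left_mono[of "norm u" 1 s] by simp
      then have "norm ((s / t) *\<^sub>R u) \<le> 1" using that False by simp
      then show "h (s *\<^sub>R u) \<le> M t" using upper[of "(s / t) *\<^sub>R u" t] False by simp
    qed
  qed (use that in auto)
  have "continuous_on {0..} M"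
    unfolding continuous_on_iff
  proof (intro ballI allI impI)
    fix s e :: real assume "s \<in> {0..}" "0 < e"
    have "uniformly_continuous_on ({0..s + 1} \<times> cball 0 1) (\<lambda>(s, u). h (s *\<^sub>R u))"
      unfolding split_def
      by (intro compact_uniformly_continuous compact_Times continuous_on_compose2[OF cont] continuous_intros) auto
    then obtain d where d: "0 < d" "\<And>p q. p \<in> {0..s + 1} \<times> cball 0 1 \<Longrightarrow> q \<in> {0..s + 1} \<times> cball 0 1 \<Longrightarrow>
        dist q p < d \<Longrightarrow> dist ((\<lambda>(s, u). h (s *\<^sub>R u)) q) ((\<lambda>(s, u). h (s *\<^sub>R u)) p) < e / 2"
      unfolding uniformly_continuous_on_def using \<open>0 < e\<close> by (meson half_gt_zero)
    have step: "M t \<le> M t' + e / 2" if "t \<in> {0..s + 1}" "t' \<in> {0..s + 1}" "dist t t' < d" for t t'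
    proof (rule least)
      fix u :: 'a assume u: "norm u \<le> 1"
      have "dist (h (t *\<^sub>R u)) (h (t' *\<^sub>R u)) < e / 2"
        using d(2)[of "(t', u)" "(t, u)"] that u by (simp add: dist_Pair_Pair)
      then show "h (t *\<^sub>R u) \<le> M t' + e / 2" using upper[OF u, of t'] unfolding dist_real_def by linarith
    qed
    have "dist (M t) (M s) < e" if "t \<in> {0..}" "dist t s < min d 1" for t
    proof -
      have "t \<in> {0..s + 1}" "s \<in> {0..s + 1}" using that \<open>s \<in> {0..}\<close> by (auto simp: dist_real_def)
      then show ?thesis
        using step[of t s] step[of s t] that(2) \<open>0 < e\<close> by (auto simp: dist_commute dist_real_def)
    qed
    then show "\<exists>d>0. \<forall>t\<in>{0..}. dist t s < d \<longrightarrow> dist (M t) (M s) < e"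
      using d(1) by (intro exI[of _ "min d 1"]) auto
  qed
  then have "class_K (\<lambda>s. s + M s)"
    unfolding class_K_def strict_mono_on_def
    using mono \<open>M 0 = 0\<close> by (auto intro!: continuous_intros add_less_le_mono)
  moreover have "h x \<le> norm x + M (norm x)" for x
    using upper[of "sgn x" "norm x"] assms(2) \<open>M 0 = 0\<close>
    by (cases "x = 0") (auto simp: norm_sgn sgn_div_norm intro: add_increasing)
  ultimately show thesis using that by blast
qed

text \<open>The rate \<open>R\<close> may tend to 0 at infinity, so it need not dominate an
  unbounded function of \<open>W\<close>. A nonincreasing factor \<open>q\<close> is built first,
  below R/W where \<open>W \<ge> 1\<close>; the quotient of \<open>R\<close> by it dominates
  \<open>W\<close> there, hence has an unbounded minorant \<open>P\<close>.\<close>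

lemma decay_rate_factorization:
  fixes R W :: "'a::euclidean_space \<Rightarrow> real"
  assumes R: "continuous_on UNIV R" "R 0 = 0" "\<And>x. x \<noteq> 0 \<Longrightarrow> 0 < R x"
    and W: "continuous_on UNIV W" "W 0 = 0" "\<And>x. x \<noteq> 0 \<Longrightarrow> 0 < W x" "filterlim W at_top at_infinity"
  obtains P q \<alpha> :: "real \<Rightarrow> real"
  where "\<And>x. P (W x) * q (W x) \<le> R x" "\<And>s t. s \<le> t \<Longrightarrow> P s \<le> P t"
    "\<And>s t. s \<le> t \<Longrightarrow> P t \<le> P s + (t - s)" "P 0 = 0"
    "class_K_inf \<alpha>" "\<And>x. \<alpha> (norm x) \<le> P (W x)"
    "\<And>s. 0 < q s" "\<And>s t. s \<le> t \<Longrightarrow> q t \<le> q s" "continuous_on UNIV q"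
proof -
  have R0: "0 \<le> R x" and W0: "0 \<le> W x" for x using R(2) R(3)[of x] W(2) W(3)[of x] by (cases "x = 0"; auto)+
  \<comment> \<open>The value 1 below level 1 is a default: \<open>R\<close> vanishes at 0 and must
    not drag \<open>q\<close> down to 0.\<close>
  define r where "r x = (if W x \<ge> 1 then R x / W x else 1)" for x
  have r0: "0 \<le> r x" for x using R0[of x] W0[of x] by (simp add: r_def)
  \<comment> \<open>Taking \<open>- W\<close> as parameter and reflecting the argument in
    \<open>q\<close> turns a nondecreasing minorant into a nonincreasing one.\<close>
  obtain Q where Q: "\<And>x. Q (- W x) \<le> r x" "\<And>s t. s \<le> t \<Longrightarrow> Q s \<le> Q t"
      "\<And>s t. s \<le> t \<Longrightarrow> Q t \<le> Q s + (t - s)" "\<And>s. 0 \<le> Q s"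
      "\<And>s c. \<forall>x. c \<le> r x + max 0 (s - (- W x)) \<Longrightarrow> c \<le> Q s"
    using mono_lipschitz_minorant[where r = r and w = "\<lambda>x. - W x", OF r0] by metis
  define q where "q s = Q (- s)" for s
  have q_le: "q (W x) * W x \<le> R x" if "1 \<le> W x" for x
    using Q(1)[of x] that by (simp add: q_def r_def le_divide_eq)
  have q_pos: "0 < q s" for s
  proof -
    have "\<exists>c>0. \<forall>x\<in>{x. 1 \<le> W x \<and> W x \<le> s + 1}. c \<le> R x / W x"
    proof (intro compact_positive_lower_bound compact_level_band W continuous_on_divide)
      show "0 < R x / W x" if "x \<in> {x. 1 \<le> W x \<and> W x \<le> s + 1}" for x
        using that R(3)[of x] W(2) by (cases "x = 0") auto
    qed (use continuous_on_subset[OF R(1)] continuous_on_subset[OF W(1)] in auto)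
    then obtain c where c: "0 < c" "\<And>x. 1 \<le> W x \<Longrightarrow> W x \<le> s + 1 \<Longrightarrow> c \<le> R x / W x" by blast
    \<comment> \<open>Up to level s + 1 of \<open>W\<close>, \<open>r\<close> is at least
      \<open>c\<close> or equal to 1; above it the cone term is at least 1.\<close>
    have "min c 1 \<le> Q (- s)"
    proof (rule Q(5), rule)
      show "min c 1 \<le> r x + max 0 (- s - - W x)" for x
        using c(2)[of x] r0[of x] by (cases "1 \<le> W x"; cases "W x \<le> s + 1") (auto simp: r_def)
    qed
    then show ?thesis using c(1) by (auto simp: q_def min_le_iff_disj)
  qed
  have q_anti: "q t \<le> q s" if "s \<le> t" for s t using Q(2)[of "- t" "- s"] that by (simp add: q_def)
  have q_cont: "continuous_on S q" for S
    unfolding q_def[abs_def]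
    by (rule continuous_on_compose2[where g = Q and t = UNIV])
      (auto intro!: continuous_on_nonexpansive_mono[where P = Q] Q(2,3) continuous_intros)
  \<comment> \<open>What remains of the rate once \<open>q\<close> is split off; by
    \<open>q_le\<close> it is at least \<open>W x\<close> wherever
    \<open>W x \<ge> 1\<close>.\<close>
  define \<rho> where "\<rho> x = R x / q (W x)" for x
  have \<rho>0: "0 \<le> \<rho> x" for x using R0[of x] q_pos[of "W x"] by (simp add: \<rho>_def)
  have \<rho>_cont: "continuous_on S \<rho>" for S
    unfolding \<rho>_def[abs_def]
    by (intro continuous_on_divide continuous_on_subset[OF R(1)]
        continuous_on_compose2[OF q_cont continuous_on_subset[OF W(1)]]) (use q_pos less_imp_neq in \<open>auto simp: less_imp_neq[symmetric]\<close>)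
  have \<rho>_large: "W x \<le> \<rho> x" if "1 \<le> W x" for x
    using q_le[OF that] q_pos[of "W x"] by (simp add: \<rho>_def le_divide_eq mult.commute)
  obtain P where P: "\<And>x. P (W x) \<le> \<rho> x" "\<And>s t. s \<le> t \<Longrightarrow> P s \<le> P t"
      "\<And>s t. s \<le> t \<Longrightarrow> P t \<le> P s + (t - s)" "\<And>s. 0 \<le> P s"
      "\<And>s c. \<forall>x. c \<le> \<rho> x + max 0 (s - W x) \<Longrightarrow> c \<le> P s"
    using mono_lipschitz_minorant[where r = \<rho> and w = W, OF \<rho>0] by metis
  have P0: "P 0 = 0" using P(1)[of 0] P(4)[of 0] R(2) W(2) by (simp add: \<rho>_def)
  have P_pos: "0 < P s" if "0 < s" for s
  proof -
    have "\<exists>c>0. \<forall>x\<in>{x. s / 2 \<le> W x \<and> W x \<le> 1}. c \<le> \<rho> x"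
    proof (intro compact_positive_lower_bound compact_level_band W \<rho>_cont)
      show "0 < \<rho> x" if "x \<in> {x. s / 2 \<le> W x \<and> W x \<le> 1}" for x
        using that \<open>0 < s\<close> R(3)[of x] W(2) q_pos[of "W x"] by (cases "x = 0") (auto simp: \<rho>_def)
    qed
    then obtain c where c: "0 < c" "\<And>x. s / 2 \<le> W x \<Longrightarrow> W x \<le> 1 \<Longrightarrow> c \<le> \<rho> x" by blast
    have "min (min c 1) (s / 2) \<le> P s"
    proof (rule P(5), rule)
      fix x
      consider "W x < s / 2" | "s / 2 \<le> W x" "W x \<le> 1" | "1 < W x" by linarith
      then show "min (min c 1) (s / 2) \<le> \<rho> x + max 0 (s - W x)"
      proof cases
        case 1
        then show ?thesis using \<rho>0[of x] by linarith
      next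
        case 2
        then show ?thesis using c(2)[of x] by linarith
      next
        case 3
        then show ?thesis using \<rho>_large[of x] by linarith
      qed
    qed
    then show ?thesis using c(1) that by linarith
  qed
  \<comment> \<open>Either \<open>W x\<close> is at least s/2, hence at least 1 and dominated by
    \<open>\<rho> x\<close>, or the cone term is at least s/2.\<close>
  have P_large: "s / 2 \<le> P s" if "2 \<le> s" for s
  proof (rule P(5), rule)
    show "s / 2 \<le> \<rho> x + max 0 (s - W x)" for x
    proof (cases "s / 2 \<le> W x")
      case True
      then have "W x \<le> \<rho> x" using that by (intro \<rho>_large) linarith
      then show ?thesis using True by linarith
    qed (use \<rho>0[of x] in linarith)
  qed
  have "filterlim P at_top at_top"
  proof (rule filterlim_at_top_mono)
    show "filterlim (\<lambda>s::real. s / 2) at_top at_top"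
      using filterlim_tendsto_pos_mult_at_top[OF tendsto_const[of "1/2"] _ filterlim_ident] by simp
    show "\<forall>\<^sub>F s in at_top. s / 2 \<le> P s"
      using eventually_ge_at_top[of 2] by eventually_elim (rule P_large)
  qed
  then have "filterlim (\<lambda>x. P (W x)) at_top at_infinity" using W(4) by (rule filterlim_compose)
  moreover have "continuous_on UNIV (\<lambda>x. P (W x))"
    by (rule continuous_on_compose2[where g = P and t = UNIV])
      (auto intro!: continuous_on_nonexpansive_mono[where P = P] P(2,3) W(1))
  ultimately obtain \<alpha> where "class_K_inf \<alpha>" "\<And>x. \<alpha> (norm x) \<le> P (W x)"
    using class_K_inf_minorant[of "\<lambda>x. P (W x)"] W(2,3) P0 P_pos by auto
  moreover have "P (W x) * q (W x) \<le> R x" for x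
    using P(1)[of x] q_pos[of "W x"] by (simp add: \<rho>_def le_divide_eq)
  ultimately show thesis using P(2,3) P0 q_pos q_anti q_cont by (intro that[of P q \<alpha>])
qed

section \<open>Integral input-to-state stability\<close>

lemma locally_ess_bounded_norm_integrable:
  assumes "locally_ess_bounded d"
  shows "(\<lambda>r. norm (d r)) integrable_on {0..T}"
proof (cases "0 \<le> T")
  case True
  then obtain M where M: "AE t in lebesgue_on {0..T}. norm (d t) \<le> M"
    using assms unfolding locally_ess_bounded_def by blast
  interpret finite_measure "lebesgue_on {0..T}" by (rule finite_measure_lebesgue_on) simp
  have "d \<in> borel_measurable (lebesgue_on {0..T})"
    using assms unfolding locally_ess_bounded_def by (auto intro: measurable_restrict_mono)
  then have "integrable (lebesgue_on {0..T}) d" using integrable_const_bound[OF M] by blast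
  then have "integrable (lebesgue_on {0..T}) (\<lambda>r. norm (d r))" by (rule integrable_norm)
  then show ?thesis by (rule integrable_on_lebesgue_on) simp
qed (simp add: integrable_on_empty)

lemma norm_integral_le_integral_norm:
  fixes \<phi> :: "real \<Rightarrow> 'a::euclidean_space"
  assumes "\<phi> absolutely_integrable_on {a..b}"
  shows "norm (integral {a..b} \<phi>) \<le> integral {a..b} (\<lambda>r. norm (\<phi> r))"
  using assms by (intro Henstock_Kurzweil_Integration.integral_norm_bound_integral)
    (auto simp: absolutely_integrable_on_def)

lemma continuous_on_primitive:
  fixes x \<phi> :: "real \<Rightarrow> 'a::euclidean_space"
  assumes "\<phi> integrable_on {0..T}" "\<And>t. t \<in> {0..T} \<Longrightarrow> x t = x 0 + integral {0..t} \<phi>"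
  shows "continuous_on {0..T} x"
proof -
  have "continuous_on {0..T} x \<longleftrightarrow> continuous_on {0..T} (\<lambda>t. x 0 + integral {0..t} \<phi>)"
    by (rule continuous_on_cong[OF refl assms(2)])
  moreover have "continuous_on {0..T} (\<lambda>t. x 0 + integral {0..t} \<phi>)"
    by (intro continuous_intros indefinite_integral_continuous_1 assms(1))
  ultimately show ?thesis by blast
qed

text \<open>The chain rule for the composition of a differentiable function with a primitive holds up to
  an arbitrarily small multiple of the variation; by additivity it suffices to check this on
  small intervals around each time.\<close>
lemma dissipation_inequality_along_primitive:
  fixes W R :: "'a::euclidean_space \<Rightarrow> real" and x \<phi> :: "real \<Rightarrow> 'a"
  assumes W: "\<And>y. (W has_derivative (\<lambda>v. gW y \<bullet> v)) (at y)" and gW: "continuous_on UNIV gW"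
    and \<phi>: "\<phi> absolutely_integrable_on {0..T}"
    and x: "\<And>t. t \<in> {0..T} \<Longrightarrow> x t = x 0 + integral {0..t} \<phi>"
    and h: "h integrable_on {0..T}"
    and dissip: "\<And>r. r \<in> {0..T} \<Longrightarrow> gW (x r) \<bullet> \<phi> r \<le> h r"
    and st: "0 \<le> s" "s \<le> t" "t \<le> T"
  shows "W (x t) - W (x s) \<le> integral {s..t} h"
proof -
  have \<phi>_int: "\<phi> integrable_on {0..T}" and n\<phi>_int: "(\<lambda>r. norm (\<phi> r)) integrable_on {0..T}"
    using \<phi> by (auto simp: absolutely_integrable_on_def)
  have sub: "f integrable_on {a..b}" if "f integrable_on {0..T}" "0 \<le> a" "b \<le> T"
    for f :: "real \<Rightarrow> 'b::euclidean_space" and a b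
    using that by (auto intro: integrable_subinterval_real)
  have comb: "integral {a..b} f + integral {b..c} f = integral {a..c} f"
    if "f integrable_on {0..T}" "0 \<le> a" "a \<le> b" "b \<le> c" "c \<le> T" for f :: "real \<Rightarrow> 'b::euclidean_space" and a b c
    using that by (intro Henstock_Kurzweil_Integration.integral_combine sub[OF that(1)]) auto
  define n where "n a b = integral {a..b} (\<lambda>r. norm (\<phi> r))" for a b
  have diff: "x b - x a = integral {a..b} \<phi>" if "0 \<le> a" "a \<le> b" "b \<le> T" for a b
  proof -
    have "x a = x 0 + integral {0..a} \<phi>" "x b = x 0 + integral {0..b} \<phi>" using that by (auto intro: x)
    then show ?thesis using comb[OF \<phi>_int, of 0 a b] that by (simp add: algebra_simps)
  qed
  have n_le: "norm (x b - x a) \<le> n a b" if "0 \<le> a" "a \<le> b" "b \<le> T" for a b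
    using norm_integral_le_integral_norm[OF absolutely_integrable_on_subinterval[OF \<phi>, of a b]] diff[OF that] that
    by (auto simp: n_def)
  have x_cont: "continuous_on {0..T} x" by (rule continuous_on_primitive[where x = x, OF \<phi>_int x])
  \<comment> \<open>One \<epsilon> pays for the first-order expansion of \<open>W\<close>, the other
    for freezing its gradient; \<open>n s t\<close> bounds the variation of
    \<open>x\<close>.\<close>
  have approx: "W (x t) - W (x s) \<le> integral {s..t} h + 2 * \<epsilon> * n s t" if "0 < \<epsilon>" for \<epsilon>
  proof -
    define P where "P a b \<longleftrightarrow> (0 \<le> a \<and> a \<le> b \<and> b \<le> T \<longrightarrow> W (x b) - W (x a) \<le> integral {a..b} h + 2 * \<epsilon> * n a b)" for a b
    \<comment> \<open>Bisection: \<open>P\<close> passes to unions of adjacent intervals and holds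
      on all short intervals around each time.\<close>
    have "P s t" using \<open>s \<le> t\<close>
    proof (induction rule: Bolzano)
      case (trans a b c)
      show ?case unfolding P_def
      proof
        assume *: "0 \<le> a \<and> a \<le> c \<and> c \<le> T"
        then have "W (x b) - W (x a) \<le> integral {a..b} h + 2 * \<epsilon> * n a b"
          "W (x c) - W (x b) \<le> integral {b..c} h + 2 * \<epsilon> * n b c"
          using trans unfolding P_def by auto
        moreover have "integral {a..b} h + integral {b..c} h = integral {a..c} h" "n a b + n b c = n a c"
          unfolding n_def by (rule comb; use * trans h n\<phi>_int in auto)+
        ultimately show "W (x c) - W (x a) \<le> integral {a..c} h + 2 * \<epsilon> * n a c"
          by (smt (verit) distrib_left)
      qed
    next
      case (local \<tau>)
      then have \<tau>: "\<tau> \<in> {0..T}" using st by auto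
      obtain e1 where e1: "0 < e1"
        "\<And>y. norm (y - x \<tau>) < e1 \<Longrightarrow> \<bar>W y - W (x \<tau>) - gW (x \<tau>) \<bullet> (y - x \<tau>)\<bar> \<le> \<epsilon> * norm (y - x \<tau>)"
        using W[of "x \<tau>"] \<open>0 < \<epsilon>\<close> unfolding has_derivative_at_alt real_norm_def by blast
      obtain e2 where e2: "0 < e2" "\<And>y. dist y (x \<tau>) < e2 \<Longrightarrow> dist (gW y) (gW (x \<tau>)) < \<epsilon>"
        using gW \<open>0 < \<epsilon>\<close> unfolding continuous_on_iff by blast
      obtain d where d: "0 < d" "\<And>r. r \<in> {0..T} \<Longrightarrow> dist r \<tau> < d \<Longrightarrow> dist (x r) (x \<tau>) < min e1 e2"
        using x_cont \<tau> e1(1) e2(1) unfolding continuous_on_iff by (metis min_less_iff_conj)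
      have "P a b" if ab: "a \<le> \<tau>" "\<tau> \<le> b" "b - a < d" for a b
        unfolding P_def
      proof
        assume *: "0 \<le> a \<and> a \<le> b \<and> b \<le> T"
        have close: "dist (x r) (x \<tau>) < min e1 e2" if "r \<in> {a..b}" for r
          using that ab * by (intro d(2)) (auto simp: dist_real_def)
        define g where "g = gW (x \<tau>)"
        have "W (x b) - W (x \<tau>) \<le> g \<bullet> (x b - x \<tau>) + \<epsilon> * norm (x b - x \<tau>)"
          using e1(2)[of "x b"] close[of b] * by (auto simp: dist_norm g_def)
        moreover have "W (x \<tau>) - W (x a) \<le> g \<bullet> (x \<tau> - x a) + \<epsilon> * norm (x \<tau> - x a)"
          using e1(2)[of "x a"] close[of a] * by (auto simp: dist_norm g_def inner_diff_right norm_minus_commute)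
        moreover have "\<epsilon> * norm (x b - x \<tau>) \<le> \<epsilon> * n \<tau> b" "\<epsilon> * norm (x \<tau> - x a) \<le> \<epsilon> * n a \<tau>"
          using ab * \<open>0 < \<epsilon>\<close> n_le by (auto intro!: mult_left_mono)
        moreover have "\<epsilon> * n a \<tau> + \<epsilon> * n \<tau> b = \<epsilon> * n a b"
          unfolding n_def distrib_left[symmetric] by (subst comb[OF n\<phi>_int]) (use ab * in auto)
        moreover have "g \<bullet> (x b - x a) = g \<bullet> (x b - x \<tau>) + g \<bullet> (x \<tau> - x a)"
          by (simp add: inner_diff_right)
        \<comment> \<open>With the gradient frozen at \<open>\<tau>\<close> the increment is the
          integral of \<open>g \<bullet> \<phi> r\<close>, which differs from the true rate by at
          most \<epsilon> times \<open>norm (\<phi> r)\<close>.\<close>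
        moreover have "g \<bullet> (x b - x a) \<le> integral {a..b} h + \<epsilon> * n a b"
        proof -
          have "g \<bullet> (x b - x a) = integral {a..b} (\<lambda>r. g \<bullet> \<phi> r)"
            using integral_linear[OF sub[OF \<phi>_int] bounded_linear_inner_right, of a b g] diff[of a b] *
            by (simp add: o_def)
          also have "\<dots> \<le> integral {a..b} (\<lambda>r. h r + \<epsilon> * norm (\<phi> r))"
          proof (rule integral_le)
            show "(\<lambda>r. g \<bullet> \<phi> r) integrable_on {a..b}"
              using integrable_linear[OF sub[OF \<phi>_int] bounded_linear_inner_right, of a b g] * by (simp add: o_def)
            show "(\<lambda>r. h r + \<epsilon> * norm (\<phi> r)) integrable_on {a..b}"
              using sub[OF h] sub[OF n\<phi>_int] * by (intro integrable_add integrable_on_mult_right) auto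
            fix r assume r: "r \<in> {a..b}"
            have "norm (g - gW (x r)) \<le> \<epsilon>"
              using e2(2)[of "x r"] close[OF r] by (simp add: g_def dist_norm norm_minus_commute)
            then have "norm (g - gW (x r)) * norm (\<phi> r) \<le> \<epsilon> * norm (\<phi> r)"
              by (intro mult_right_mono) auto
            then have "(g - gW (x r)) \<bullet> \<phi> r \<le> \<epsilon> * norm (\<phi> r)"
              using norm_cauchy_schwarz[of "g - gW (x r)" "\<phi> r"] by linarith
            then show "g \<bullet> \<phi> r \<le> h r + \<epsilon> * norm (\<phi> r)"
              using dissip[of r] r * by (auto simp: inner_diff_left)
          qed
          also have "\<dots> = integral {a..b} h + \<epsilon> * n a b"
            unfolding n_def using sub[OF h] sub[OF n\<phi>_int] *
            by (subst Henstock_Kurzweil_Integration.integral_add) (auto intro: integrable_on_mult_right)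
          finally show ?thesis .
        qed
        ultimately show "W (x b) - W (x a) \<le> integral {a..b} h + 2 * \<epsilon> * n a b" by linarith
      qed
      then show ?case using d(1) by blast
    qed
    then show ?thesis using st unfolding P_def by auto
  qed
  show ?thesis
  proof (rule field_le_epsilon)
    fix e :: real assume "0 < e"
    have n0: "0 \<le> n s t" using n_le[OF st] norm_ge_zero[of "x t - x s"] by linarith
    \<comment> \<open>The value of \<epsilon> for the limit is e / (2 (n + 1)); the added 1 covers a
      vanishing \<open>n s t\<close>.\<close>
    have "2 * (e / (2 * (n s t + 1))) * n s t = e * (n s t / (n s t + 1))" using n0 by (simp add: field_simps)
    also have "\<dots> \<le> e * 1" using n0 \<open>0 < e\<close> by (intro mult_left_mono) (auto simp: divide_le_eq)
    finally have "2 * (e / (2 * (n s t + 1))) * n s t \<le> e" by simp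
    moreover have "0 < e / (2 * (n s t + 1))" using n0 \<open>0 < e\<close> by simp
    ultimately show "W (x t) - W (x s) \<le> integral {s..t} h + e" using approx by fastforce
  qed
qed

text \<open>\<open>R\<close> is merely positive definite, so both conclusions pass through
  \<open>decay_rate_factorization\<close>: \<open>\<alpha>\<close> and \<open>q\<close> give the
  rate of the CLF, \<open>P\<close> and \<open>q\<close> the decay of trajectories.\<close>

lemma iISS_of_dissipation:
  fixes W R :: "real^'n \<Rightarrow> real" and \<Phi> :: "real^'n \<Rightarrow> real^'m \<Rightarrow> real^'n"
  assumes W: "\<And>y. (W has_derivative (\<lambda>v. gradient W y \<bullet> v)) (at y)" "continuous_on UNIV (gradient W)"
      "positive_definite W" "radially_unbounded W"
    and R: "continuous_on UNIV R" "R 0 = 0" "\<And>x. x \<noteq> 0 \<Longrightarrow> 0 < R x"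
    and "0 < c" and dissip: "\<And>x d. gradient W x \<bullet> \<Phi> x d \<le> - R x + c * norm d"
  shows "iISS \<Phi> \<and> iISS_CLF \<Phi> W"
proof
  have W_cont: "continuous_on UNIV W"
    using W(1) by (meson has_derivative_continuous continuous_at_imp_continuous_on)
  have Wpd: "W 0 = 0" "\<And>x. x \<noteq> 0 \<Longrightarrow> 0 < W x" and Winf: "filterlim W at_top at_infinity"
    using W(3,4) unfolding positive_definite_def radially_unbounded_def by auto
  have W0: "0 \<le> W x" for x using Wpd(1) Wpd(2)[of x] by (cases "x = 0") auto
  obtain P q \<alpha> :: "real \<Rightarrow> real"
    where PqR: "\<And>x. P (W x) * q (W x) \<le> R x" and P: "\<And>s t. s \<le> t \<Longrightarrow> P s \<le> P t"
    "\<And>s t. s \<le> t \<Longrightarrow> P t \<le> P s + (t - s)" "P 0 = 0"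
    and \<alpha>: "class_K_inf \<alpha>" "\<And>x. \<alpha> (norm x) \<le> P (W x)"
    and q: "\<And>s. 0 < q s" "\<And>s t. s \<le> t \<Longrightarrow> q t \<le> q s" "continuous_on UNIV q"
    using decay_rate_factorization[OF R W_cont Wpd Winf] by metis
  obtain \<alpha>2 where \<alpha>2: "class_K \<alpha>2" "\<And>x. W x \<le> \<alpha>2 (norm x)"
    using class_K_majorant[OF W_cont Wpd(1)] by metis
  have P0: "0 \<le> P s" if "0 \<le> s" for s using P(1)[OF that] P(3) by simp
  have \<alpha>2_cont: "continuous_on {0..} \<alpha>2" and \<alpha>2_mono: "\<And>s t. 0 \<le> s \<Longrightarrow> s < t \<Longrightarrow> \<alpha>2 s < \<alpha>2 t" and "\<alpha>2 0 = 0"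
    using \<alpha>2(1) by (auto simp: class_K_def strict_mono_on_def)
  have \<alpha>2_0: "0 \<le> \<alpha>2 s" if "0 \<le> s" for s
    using \<alpha>2_mono[of 0 s] \<open>\<alpha>2 0 = 0\<close> that by (cases "s = 0") auto
  show "iISS_CLF \<Phi> W"
  proof -
    \<comment> \<open>Built to depend on the norm alone:
      \<open>\<alpha> (norm x) \<le> P (W x)\<close>, and
      \<open>q (\<alpha>2 (norm x)) \<le> q (W x)\<close> because \<open>\<alpha>2 (norm x)\<close>
      bounds \<open>W x\<close> and \<open>q\<close> is nonincreasing.\<close>
    define \<alpha>5 where "\<alpha>5 s = \<alpha> s * q (\<alpha>2 s)" for s
    have "continuous_on {0..} \<alpha>5"
      unfolding \<alpha>5_def[abs_def] using \<alpha>(1) unfolding class_K_inf_def class_K_def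
      by (intro continuous_on_mult continuous_on_compose2[OF q(3) \<alpha>2_cont]) auto
    moreover have "\<alpha>5 0 = 0" using \<alpha>(1) by (simp add: \<alpha>5_def class_K_inf_def class_K_def)
    moreover have "0 < \<alpha>5 s" if "0 < s" for s
      using \<alpha>(1) that q(1) strict_mono_onD[of "{0..}" \<alpha> 0 s]
      by (auto simp: \<alpha>5_def class_K_inf_def class_K_def)
    moreover have "\<alpha>5 (norm x) \<le> R x" for x
    proof -
      have "\<alpha>5 (norm x) \<le> P (W x) * q (W x)"
        unfolding \<alpha>5_def using \<alpha>(2)[of x] q(2)[OF \<alpha>2(2), of x] P0[OF W0] q(1)
        by (intro mult_mono) (auto simp: less_imp_le)
      then show ?thesis using PqR[of x] by linarith
    qed
    then have "gradient W x \<bullet> \<Phi> x d \<le> - \<alpha>5 (norm x) + c * norm d" for x d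
      using dissip[of x d] by (smt (verit))
    moreover have "class_K (\<lambda>s. c * s)"
      using \<open>0 < c\<close> by (auto simp: class_K_def strict_mono_on_def intro!: continuous_intros)
    moreover have "W differentiable_on UNIV"
      using W(1) by (auto simp: differentiable_on_def intro: differentiableI)
    ultimately show ?thesis using W(3,4) unfolding iISS_CLF_def by blast
  qed
  \<comment> \<open>The decay bound y(0) / (1 + t q(2 y(0))), with \<open>\<alpha>2 s\<close>
    replacing y(0) = W(x(0)).\<close>
  define \<beta> where "\<beta> s t = \<alpha>2 s / (1 + t * q (2 * \<alpha>2 s))" for s t
  \<comment> \<open>The factor 2 reflects the case in which only W(x(T)) <= 2 z(T) is known.\<close>
  define \<gamma> where "\<gamma> s = 2 * c * s" for s
  \<comment> \<open>The numerator grows while the denominator does not, since \<open>q\<close> is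
    nonincreasing.\<close>
  have \<beta>_mono: "a / (1 + t * q (2 * a)) \<le> b / (1 + t * q (2 * b))"
    and \<beta>_strict: "a < b \<Longrightarrow> a / (1 + t * q (2 * a)) < b / (1 + t * q (2 * b))" if "0 \<le> t" "0 \<le> a" "a \<le> b" for a b t
  proof -
    have D: "0 < 1 + t * q (2 * b)" "1 + t * q (2 * b) \<le> 1 + t * q (2 * a)"
      using that q(1)[of "2 * b"] q(2)[of "2 * a" "2 * b"] by (auto intro!: mult_left_mono add_pos_nonneg)
    show "a / (1 + t * q (2 * a)) \<le> b / (1 + t * q (2 * b))"
      using D that by (intro frac_le) auto
    show "a / (1 + t * q (2 * a)) < b / (1 + t * q (2 * b))" if "a < b"
      using D that \<open>0 \<le> a\<close> by (intro frac_less) auto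
  qed
  have D_pos: "0 < 1 + t * q s" if "0 \<le> t" for t s using that q(1)[of s] by (intro add_pos_nonneg) auto
  have D_nz: "1 + t * q s \<noteq> 0" if "0 \<le> t" for t s using D_pos[OF that, of s] by simp
  have "class_KL \<beta>"
    unfolding class_KL_def
  proof (intro conjI allI impI)
    have q\<alpha>2: "continuous_on ({0..} \<times> {0..}) (\<lambda>p::real \<times> real. \<alpha>2 (fst p))"
      by (rule continuous_on_compose2[OF \<alpha>2_cont]) (auto intro: continuous_intros)
    show "continuous_on ({0..} \<times> {0..}) (\<lambda>(s, t). \<beta> s t)"
      unfolding \<beta>_def split_def
      by (intro continuous_intros q\<alpha>2 continuous_on_compose2[OF q(3)])
        (auto simp: D_nz)
    fix t :: real assume "0 \<le> t"
    show "class_K (\<lambda>s. \<beta> s t)"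
      unfolding class_K_def
    proof (intro conjI strict_mono_onI)
      show "continuous_on {0..} (\<lambda>s. \<beta> s t)"
        unfolding \<beta>_def
        by (intro continuous_intros \<alpha>2_cont continuous_on_compose2[OF q(3)])
          (auto simp: D_nz \<open>0 \<le> t\<close>)
      show "\<beta> a t < \<beta> b t" if "a \<in> {0..}" "a < b" for a b
        unfolding \<beta>_def using \<beta>_strict[OF \<open>0 \<le> t\<close> \<alpha>2_0, of a "\<alpha>2 b"] \<alpha>2_mono[of a b] that by auto
      show "\<beta> 0 t = 0" by (simp add: \<beta>_def \<open>\<alpha>2 0 = 0\<close>)
    qed
  next
    fix s :: real assume "0 \<le> s"
    show "antimono_on {0..} (\<beta> s)"
    proof (rule monotone_onI)
      fix a b :: real assume ab: "a \<in> {0..}" "b \<in> {0..}" "a \<le> b"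
      then have "1 + a * q (2 * \<alpha>2 s) \<le> 1 + b * q (2 * \<alpha>2 s)"
        using q(1)[of "2 * \<alpha>2 s"] by (auto intro!: mult_right_mono)
      then show "\<beta> s b \<le> \<beta> s a"
        unfolding \<beta>_def using ab D_pos \<alpha>2_0[OF \<open>0 \<le> s\<close>] by (intro divide_left_mono mult_pos_pos) auto
    qed
    have "filterlim (\<lambda>t. 1 + q (2 * \<alpha>2 s) * t) at_top at_top"
      by (rule filterlim_tendsto_add_at_top[OF tendsto_const])
        (rule filterlim_tendsto_pos_mult_at_top[OF tendsto_const q(1) filterlim_ident])
    then show "(\<beta> s \<longlongrightarrow> 0) at_top"
      unfolding \<beta>_def[abs_def] mult.commute[of _ "q _"]
      by (rule real_tendsto_divide_at_top[OF tendsto_const])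
  qed
  moreover have "class_K_inf \<gamma>"
    unfolding class_K_inf_def class_K_def strict_mono_on_def \<gamma>_def[abs_def]
    using \<open>0 < c\<close> by (auto intro!: continuous_intros filterlim_tendsto_pos_mult_at_top[OF tendsto_const] filterlim_ident)
  moreover have "\<alpha> (norm (x T)) \<le> \<beta> (norm (x 0)) T + integral {0..T} (\<lambda>s. \<gamma> (norm (d s)))"
    if d: "locally_ess_bounded d" and I: "is_interval I" "0 \<in> I" "I \<subseteq> {0..}" "trajectory_on I \<Phi> d x" "T \<in> I"
    for d I x T
  proof -
    have T: "0 \<le> T" using I by auto
    \<comment> \<open>Only [0, T] matters from here on, so trajectories not defined for all time are
      treated alike.\<close>
    have TI: "{0..T} \<subseteq> I" using mem_is_interval_1_I[OF I(1,2,5)] by auto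
    define \<phi> where "\<phi> s = \<Phi> (x s) (d s)" for s
    have traj: "\<phi> absolutely_integrable_on {0..t} \<and> x t = x 0 + integral {0..t} \<phi>" if "t \<in> I" for t
      using bspec[OF I(4)[unfolded trajectory_on_def] that] unfolding \<phi>_def[abs_def] .
    have \<phi>: "\<phi> absolutely_integrable_on {0..T}" using traj[OF I(5)] by (rule conjunct1)
    have x: "x t = x 0 + integral {0..t} \<phi>" if "t \<in> {0..T}" for t
      using traj[OF subsetD[OF TI that]] by (rule conjunct2)
    have \<phi>_int: "\<phi> integrable_on {0..T}" using \<phi> by (auto simp: absolutely_integrable_on_def)
    have x_cont: "continuous_on {0..T} x" by (rule continuous_on_primitive[where x = x, OF \<phi>_int x])
    have Rx_cont: "continuous_on {0..T} (\<lambda>r. R (x r))"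
      by (rule continuous_on_compose2[OF R(1) x_cont]) auto
    have Rx_int: "(\<lambda>r. R (x r)) integrable_on {a..b}" if "0 \<le> a" "b \<le> T" for a b
      using that by (intro integrable_continuous_real continuous_on_subset[OF Rx_cont]) auto
    have d_int: "(\<lambda>r. c * norm (d r)) integrable_on {a..b}" if "0 \<le> a" for a b
      using that by (intro integrable_on_mult_right integrable_subinterval_real[OF locally_ess_bounded_norm_integrable[OF d, of b]]) auto
    define z where "z t = integral {0..t} (\<lambda>r. c * norm (d r))" for t
    define y where "y t = W (x t) - z t" for t
    have z_diff: "z b - z a = integral {a..b} (\<lambda>r. c * norm (d r))" if "0 \<le> a" "a \<le> b" for a b
      using Henstock_Kurzweil_Integration.integral_combine[OF that d_int[of 0 b]] by (simp add: z_def)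
    have z_mono: "z a \<le> z b" if "0 \<le> a" "a \<le> b" for a b
    proof -
      have "0 \<le> integral {a..b} (\<lambda>r. c * norm (d r))"
        using \<open>0 < c\<close> that by (intro integral_nonneg d_int) auto
      then show ?thesis using z_diff[OF that] by linarith
    qed
    have "z 0 = 0" by (simp add: z_def)
    \<comment> \<open>Subtracting the accumulated gain cancels the disturbance, so \<open>y\<close>
      loses at least the integral of \<open>R\<close>.\<close>
    have y_decr: "y b \<le> y a - integral {a..b} (\<lambda>r. R (x r))" if "0 \<le> a" "a \<le> b" "b \<le> T" for a b
    proof -
      have "W (x b) - W (x a) \<le> integral {a..b} (\<lambda>r. c * norm (d r) - R (x r))"
      proof (rule dissipation_inequality_along_primitive[where x = x, OF W(1,2) \<phi> x _ _ that])
        show "(\<lambda>r. c * norm (d r) - R (x r)) integrable_on {0..T}"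
          using Rx_int[of 0 T] d_int[of 0 T] by (intro integrable_diff) auto
        show "gradient W (x r) \<bullet> \<phi> r \<le> c * norm (d r) - R (x r)" for r
          using dissip[of "x r" "d r"] by (simp add: \<phi>_def)
      qed
      also have "\<dots> = z b - z a - integral {a..b} (\<lambda>r. R (x r))"
        unfolding z_diff[OF that(1,2)]
        by (rule Henstock_Kurzweil_Integration.integral_diff[OF d_int[OF that(1)] Rx_int[OF that(1,3)]])
      finally show ?thesis by (simp add: y_def)
    qed
    have R0: "0 \<le> R v" for v using R(2) R(3)[of v] by (cases "v = 0") auto
    have y_mono: "y b \<le> y a" if "0 \<le> a" "a \<le> b" "b \<le> T" for a b
    proof -
      have "0 \<le> integral {a..b} (\<lambda>r. R (x r))" using R0 that by (intro integral_nonneg Rx_int) auto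
      then show ?thesis using y_decr[OF that] by linarith
    qed
    have zT: "0 \<le> z T" using z_mono[of 0 T] \<open>z 0 = 0\<close> T by simp
    have "P (W (x T)) \<le> \<beta> (norm (x 0)) T + 2 * z T"
    proof (cases "y T \<le> z T")
      case True
      have "P (W (x T)) \<le> W (x T)" using P(2)[OF W0, of "x T"] P(3) by simp
      moreover have "0 \<le> \<beta> (norm (x 0)) T"
        unfolding \<beta>_def using D_pos[OF T] \<alpha>2_0 by (intro divide_nonneg_pos) auto
      ultimately show ?thesis using True by (simp add: y_def)
    next
      case False
      have y0: "y 0 = W (x 0)" by (simp add: y_def \<open>z 0 = 0\<close>)
      have yT: "0 \<le> y T" using False zT by linarith
      \<comment> \<open>Here 0 <= z <= z(T) < y(T), so \<open>W (x r)\<close> lies between y(T) and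
        2 y(0); \<open>P\<close> is bounded below at the left end and \<open>q\<close> at the right
        end.\<close>
      have rate: "P (y T) * q (2 * y 0) \<le> R (x r)" if r: "r \<in> {0..T}" for r
      proof -
        have "y T \<le> y r" "y r \<le> y 0" "0 \<le> z r" "z r \<le> z T"
          using y_mono[of r T] y_mono[of 0 r] z_mono[of 0 r] z_mono[of r T] \<open>z 0 = 0\<close> r by auto
        then have "y T \<le> W (x r)" "W (x r) \<le> 2 * y 0" using False by (auto simp: y_def)
        then have "P (y T) * q (2 * y 0) \<le> P (W (x r)) * q (W (x r))"
          using P(1) q P0[OF W0] by (intro mult_mono) (auto simp: less_imp_le)
        then show ?thesis using PqR[of "x r"] by linarith
      qed
      have "integral {0..T} (\<lambda>r. P (y T) * q (2 * y 0)) \<le> integral {0..T} (\<lambda>r. R (x r))"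
        using rate Rx_int[of 0 T] by (intro integral_le) auto
      then have "y T \<le> y 0 - T * (P (y T) * q (2 * y 0))"
        using y_decr[of 0 T] T by (simp add: algebra_simps)
      \<comment> \<open>Replacing y(T) by P(y(T)) on the smaller side allows P(y(T)) to be factored
        out.\<close>
      moreover have "P (y T) \<le> y T" using P(2)[OF yT] P(3) by simp
      ultimately have "P (y T) * (1 + T * q (2 * y 0)) \<le> y 0" by (simp add: algebra_simps)
      then have "P (y T) \<le> y 0 / (1 + T * q (2 * y 0))" using D_pos[OF T] by (simp add: le_divide_eq)
      also have "\<dots> \<le> \<beta> (norm (x 0)) T"
        unfolding \<beta>_def using \<beta>_mono[OF T W0 \<alpha>2(2)[of "x 0"]] y0 by simp
      finally have "P (y T) \<le> \<beta> (norm (x 0)) T" .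
      \<comment> \<open>Nonexpansiveness of \<open>P\<close> carries the bound from y(T) to W(x(T))
        at the cost z(T).\<close>
      moreover have "P (W (x T)) \<le> P (y T) + z T" using P(2)[of "y T" "W (x T)"] zT by (simp add: y_def)
      ultimately show ?thesis using zT by linarith
    qed
    moreover have "integral {0..T} (\<lambda>s. \<gamma> (norm (d s))) = 2 * z T"
      unfolding z_def \<gamma>_def by (subst integral_mult_right[symmetric]) (simp add: mult.assoc)
    ultimately show ?thesis using \<alpha>(2)[of "x T"] by linarith
  qed
  ultimately show "iISS \<Phi>" using \<alpha>(1) unfolding iISS_def by blast
qed

section \<open>The control Lyapunov function\<close>

lemma has_derivative_gradient:
  fixes V :: "real^'n \<Rightarrow> real"
  assumes "V differentiable (at x)"
  shows "(V has_derivative (\<lambda>v. gradient V x \<bullet> v)) (at x)"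
proof -
  have *: "(V has_derivative frechet_derivative V (at x)) (at x)"
    using assms frechet_derivative_works by blast
  interpret linear "frechet_derivative V (at x)" by (rule has_derivative_linear[OF *])
  have "frechet_derivative V (at x) v = gradient V x \<bullet> v" for v
  proof -
    have "frechet_derivative V (at x) v = frechet_derivative V (at x) (\<Sum>i\<in>UNIV. v $ i *\<^sub>R axis i 1)"
      using basis_expansion[of v] by (simp add: scalar_mult_eq_scaleR)
    also have "\<dots> = gradient V x \<bullet> v"
      by (simp add: sum scale gradient_def inner_vec_def mult.commute)
    finally show ?thesis .
  qed
  then have "frechet_derivative V (at x) = (\<lambda>v. gradient V x \<bullet> v)" by blast
  then show ?thesis using * by simp
qed

lemma gradient_eqI:
  fixes V :: "real^'n \<Rightarrow> real"
  assumes "(V has_derivative (\<lambda>v. a \<bullet> v)) (at x)"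
  shows "gradient V x = a"
  unfolding gradient_def frechet_derivative_at[OF assms, symmetric]
  by (simp add: vec_eq_iff inner_axis)

lemma smooth_on_UNIV_gradient:
  fixes V :: "real^'n \<Rightarrow> real"
  assumes "smooth_on UNIV V"
  shows "(V has_derivative (\<lambda>v. gradient V x \<bullet> v)) (at x)" "continuous_on UNIV (gradient V)"
proof -
  have *: "C_k_on (Suc 0) UNIV V" using assms unfolding smooth_on_def by blast
  then show "(V has_derivative (\<lambda>v. gradient V x \<bullet> v)) (at x)"
    by (intro has_derivative_gradient) (simp add: differentiable_on_def)
  show "continuous_on UNIV (gradient V)"
    unfolding gradient_def[abs_def] using * by (intro continuous_on_vec_lambda) simp
qed

lemma continuous_on_vector_matrix_mult:
  fixes v :: "'a::topological_space \<Rightarrow> real^'n" and A :: "'a \<Rightarrow> real^'m^'n"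
  assumes "continuous_on S v" "continuous_on S A"
  shows "continuous_on S (\<lambda>x. v x v* A x)"
  unfolding vector_matrix_mult_def using assms by (intro continuous_intros)

lemma continuous_on_matrix_vector_mult:
  fixes v :: "'a::topological_space \<Rightarrow> real^'m" and A :: "'a \<Rightarrow> real^'m^'n"
  assumes "continuous_on S v" "continuous_on S A"
  shows "continuous_on S (\<lambda>x. A x *v v x)"
  unfolding matrix_vector_mult_def using assms by (intro continuous_intros)

text \<open>Since \<open>D\<close> is nondecreasing, D + 1 is at most (1 + 1/D(0)) D, so adding 1
  and doubling the argument preserve the divergence of the integral.\<close>

lemma integral_reciprocal_reparametrization:
  fixes D :: "real \<Rightarrow> real"
  assumes D: "smooth_on {0..} D" "\<And>s. 0 \<le> s \<Longrightarrow> 0 < D s" "mono_on {0..} D"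
    and div: "filterlim (\<lambda>T. integral {0..T} (\<lambda>s. 1 / D s)) at_top at_top"
  defines "\<theta> \<equiv> \<lambda>p. 1 / (D (2 * p) + 1)"
  defines "\<Theta> \<equiv> \<lambda>r. integral {0..r} \<theta>"
  shows "continuous_on {0..} \<theta>" "\<And>r. 0 \<le> r \<Longrightarrow> (\<Theta> has_real_derivative \<theta> r) (at r within {0..})"
    "smooth_on {0..} \<Theta>" "\<And>r. 0 < r \<Longrightarrow> 0 < \<Theta> r" "filterlim \<Theta> at_top at_top"
proof -
  have pos: "0 < D (2 * p) + 1" if "0 \<le> p" for p using D(2)[of "2 * p"] that by simp
  have double: "C_k_on k {0..} (\<lambda>p::real. 2 * p)" for k
    by (rule C_k_on_bounded_linear[OF thick_Ici bounded_linear_mult_right])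
  have "C_k_on k {0..} (\<lambda>p. inverse (D (2 * p) + 1))" for k
  proof (intro C_k_on_inverse C_k_on_add C_k_on_const thick_Ici)
    show "C_k_on k {0..} (\<lambda>p. D (2 * p))"
      by (rule C_k_on_compose[OF thick_Ici thick_Ici _ _ double]) (use D(1) in \<open>auto simp: smooth_on_def\<close>)
  qed (use pos in \<open>auto simp: less_imp_neq[symmetric]\<close>)
  then have \<theta>_smooth: "smooth_on {0..} \<theta>" by (simp add: smooth_on_def \<theta>_def inverse_eq_divide)
  then show \<theta>_cont: "continuous_on {0..} \<theta>" unfolding smooth_on_def by (metis C_k_on.simps(1))
  show \<Theta>: "(\<Theta> has_real_derivative \<theta> r) (at r within {0..})" if "0 \<le> r" for r
  proof -
    \<comment> \<open>Going past \<open>r\<close> to r + 1 makes the compact interval agree with the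
      half-line near \<open>r\<close>.\<close>
    have "(\<Theta> has_real_derivative \<theta> r) (at r within {0..r + 1})"
      unfolding \<Theta>_def by (rule integral_has_real_derivative[OF continuous_on_subset[OF \<theta>_cont]]) (use that in auto)
    moreover have "at r within {0..r + 1} = at r within {0..}"
      by (rule at_within_nhd[of _ "{..<r + 1}"]) auto
    ultimately show ?thesis by simp
  qed
  show "smooth_on {0..} \<Theta>" by (rule smooth_on_antiderivative[OF thick_Ici \<theta>_smooth]) (simp add: \<Theta>)
  have \<theta>_anti: "\<theta> q \<le> \<theta> p" if "0 \<le> p" "p \<le> q" for p q
    unfolding \<theta>_def using that pos[of p] pos[of q] mono_onD[OF D(3), of "2 * p" "2 * q"]
    by (intro divide_left_mono) auto
  have \<theta>_int: "\<theta> integrable_on {0..r}" for r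
    by (rule integrable_continuous_real[OF continuous_on_subset[OF \<theta>_cont]]) auto
  show "0 < \<Theta> r" if "0 < r" for r
  proof -
    have "integral {0..r} (\<lambda>p. \<theta> r) \<le> \<Theta> r"
      unfolding \<Theta>_def using \<theta>_anti \<theta>_int by (intro integral_le) auto
    moreover have "0 < r * \<theta> r" using that pos[of r] by (simp add: \<theta>_def)
    ultimately show ?thesis using that by simp
  qed
  \<comment> \<open>Twice \<open>\<kappa>\<close> is D(0) / (1 + D(0)), the ratio by which
    \<open>\<theta> s\<close> dominates \<open>1 / D (2 * s)\<close>; the 2 cancels against the
    change of variable.\<close>
  define \<kappa> where "\<kappa> = D 0 / (2 * (1 + D 0))"
  have \<kappa>: "0 < \<kappa>" using D(2)[of 0] by (simp add: \<kappa>_def)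
  have D_int: "(\<lambda>s. 1 / D s) integrable_on {0..T}" for T
  proof (rule integrable_continuous_real)
    have "continuous_on {0..} D" using D(1) unfolding smooth_on_def by (metis C_k_on.simps(1))
    then have "continuous_on {0..T} D" by (rule continuous_on_subset) auto
    then show "continuous_on {0..T} (\<lambda>s. 1 / D s)"
      using D(2) by (intro continuous_on_divide continuous_on_const) (auto simp: less_imp_neq[symmetric])
  qed
  have lower: "\<kappa> * integral {0..2 * r} (\<lambda>s. 1 / D s) \<le> \<Theta> r" if "0 \<le> r" for r
  proof -
    have "((\<lambda>s. 1 / D (2 * s)) has_integral (1 / \<bar>2\<bar>) *\<^sub>R integral {0..2 * r} (\<lambda>s. 1 / D s)) ((\<lambda>s. s / 2) ` {0..2 * r})"
      by (rule has_integral_stretch_real[OF integrable_integral[OF D_int]]) simp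
    moreover have "(\<lambda>s::real. s / 2) ` {0..2 * r} = {0..r}"
      using image_affinity_atLeastAtMost_div[of 2 0 0 "2 * r"] that by auto
    ultimately have half: "((\<lambda>s. 1 / D (2 * s)) has_integral integral {0..2 * r} (\<lambda>s. 1 / D s) / 2) {0..r}" by simp
    have "((\<lambda>s. 2 * \<kappa> * (1 / D (2 * s))) has_integral 2 * \<kappa> * (integral {0..2 * r} (\<lambda>s. 1 / D s) / 2)) {0..r}"
      by (rule has_integral_mult_right[OF half])
    moreover have "2 * \<kappa> * (1 / D (2 * s)) \<le> \<theta> s" if "s \<in> {0..r}" for s
    proof -
      have "D 0 \<le> D (2 * s)" using that by (intro mono_onD[OF D(3)]) auto
      moreover have "0 < D 0" using D(2) by simp
      ultimately show ?thesis
        unfolding \<kappa>_def \<theta>_def by (simp add: divide_simps) (simp add: algebra_simps)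
    qed
    ultimately have "2 * \<kappa> * (integral {0..2 * r} (\<lambda>s. 1 / D s) / 2) \<le> \<Theta> r"
      unfolding \<Theta>_def by (rule has_integral_le[OF _ integrable_integral[OF \<theta>_int]])
    then show ?thesis by simp
  qed
  show "filterlim \<Theta> at_top at_top"
  proof (rule filterlim_at_top_mono)
    have "filterlim (\<lambda>r::real. 2 * r) at_top at_top"
      by (rule filterlim_tendsto_pos_mult_at_top[OF tendsto_const _ filterlim_ident]) simp
    then show "filterlim (\<lambda>r. \<kappa> * integral {0..2 * r} (\<lambda>s. 1 / D s)) at_top at_top"
      by (intro filterlim_tendsto_pos_mult_at_top[OF tendsto_const \<kappa>] filterlim_compose[OF div])
    show "\<forall>\<^sub>F r in at_top. \<kappa> * integral {0..2 * r} (\<lambda>s. 1 / D s) \<le> \<Theta> r"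
      using eventually_ge_at_top[of 0] by eventually_elim (rule lower)
  qed
qed

text \<open>The constant is a positive lower bound of v / (abs g + 1), where the added 1 admits
  zeros of \<open>g\<close>.\<close>

lemma compact_uniform_smallness:
  fixes g v :: "'a::topological_space \<Rightarrow> real"
  assumes "compact C" "continuous_on C g" "continuous_on C v" "\<And>x. x \<in> C \<Longrightarrow> 0 < v x"
  shows "\<exists>c>0. \<forall>x\<in>C. \<forall>\<delta>. \<bar>\<delta>\<bar> \<le> c \<longrightarrow> \<bar>\<delta> * g x\<bar> \<le> v x"
proof -
  have "\<exists>c>0. \<forall>x\<in>C. c \<le> v x / (\<bar>g x\<bar> + 1)"
    using assms by (intro compact_positive_lower_bound continuous_intros)
      (auto intro: divide_pos_pos add_nonneg_pos simp: add_nonneg_eq_0_iff)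
  then obtain c where c: "0 < c" "\<And>x. x \<in> C \<Longrightarrow> c \<le> v x / (\<bar>g x\<bar> + 1)" by blast
  have "\<bar>\<delta> * g x\<bar> \<le> v x" if "x \<in> C" "\<bar>\<delta>\<bar> \<le> c" for x \<delta>
  proof -
    have "\<bar>\<delta> * g x\<bar> \<le> c * (\<bar>g x\<bar> + 1)"
      unfolding abs_mult using that(2) c(1) by (intro mult_mono) auto
    also have "\<dots> \<le> v x" using c(2)[OF that(1)] by (simp add: pos_le_divide_eq add_nonneg_pos)
    finally show ?thesis .
  qed
  then show ?thesis using c(1) by blast
qed

text \<open>Where \<open>q\<close> is negative, every positive \<delta> works. The other points form
  a compact set on which \<open>p\<close> cannot vanish, so \<open>compact_uniform_smallness\<close>
  applies; its bound p/2 gives strictness.\<close>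

lemma compact_strict_decrease:
  fixes p q :: "'a::topological_space \<Rightarrow> real"
  assumes C: "compact C" "continuous_on C p" "continuous_on C q"
    and p: "\<And>x. x \<in> C \<Longrightarrow> 0 \<le> p x" "\<And>x. x \<in> C \<Longrightarrow> p x = 0 \<Longrightarrow> q x < 0"
  shows "\<exists>c>0. \<forall>x\<in>C. \<forall>\<delta>. 0 < \<delta> \<and> \<delta> \<le> c \<longrightarrow> \<delta> * q x < p x"
proof -
  define C' where "C' = C \<inter> q -` {0..}"
  have "closedin (top_of_set C) C'" unfolding C'_def by (rule continuous_closedin_preimage[OF C(3)]) simp
  then have "compact C'" by (rule closedin_compact[OF C(1)])
  moreover have "continuous_on C' q" "continuous_on C' (\<lambda>x. p x / 2)"
    using C by (auto simp: C'_def intro!: continuous_intros elim: continuous_on_subset)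
  moreover have pos: "0 < p x / 2" if "x \<in> C'" for x
    using p[of x] that by (cases "p x = 0") (auto simp: C'_def)
  ultimately obtain c where c: "0 < c" "\<And>x \<delta>. x \<in> C' \<Longrightarrow> \<bar>\<delta>\<bar> \<le> c \<Longrightarrow> \<bar>\<delta> * q x\<bar> \<le> p x / 2"
    using compact_uniform_smallness[of C' q "\<lambda>x. p x / 2"] by blast
  have "\<delta> * q x < p x" if "x \<in> C" "0 < \<delta>" "\<delta> \<le> c" for x \<delta>
  proof (cases "q x < 0")
    case True
    then have "\<delta> * q x < 0" using \<open>0 < \<delta>\<close> by (rule mult_pos_neg[rotated])
    then show ?thesis using p(1)[OF that(1)] by linarith
  next
    case False
    then have "x \<in> C'" using that by (simp add: C'_def)
    then show ?thesis using c(2)[of x \<delta>] pos[of x] that by auto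
  qed
  then show ?thesis using c(1) by blast
qed

theorem corollary4:
  fixes F :: "(real^'n) \<times> (real^'m) \<Rightarrow> real^'n"
    and f G :: "real^'n \<Rightarrow> real^'n"
    and g :: "real^'n \<Rightarrow> real^'m^'n"
    and V :: "real^'n \<Rightarrow> real"
    and \<D> :: "real \<Rightarrow> real"
    and \<epsilon> :: real
  assumes F_C1: "C_k_on 1 UNIV F"
    and F_0: "F (0, 0) = 0"
    and F_C2_u: "continuous_second_partials_in_input F"
    and f_eq: "\<And>x. f x = F (x, 0)"
    and g_eq: "\<And>x. g x = jacobian (\<lambda>u. F (x, u)) (at 0)"
    and g_C1: "C_k_on 1 UNIV g"
    and A1: "smooth_on UNIV V" "positive_definite V" "radially_unbounded V"
      "\<And>x. lie f V x \<le> 0"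
    and LGV_smooth: "smooth_on UNIV (lie G V)"
    and A2: "\<And>x. x \<noteq> 0 \<Longrightarrow> lie_matrix g V x = 0 \<Longrightarrow>
      lie f (lie G V) x < 0 \<or> lie f V x < 0"
    and A3: "smooth_on {0..} \<D>" "\<And>s. 0 \<le> s \<Longrightarrow> 0 < \<D> s" "mono_on {0..} \<D>"
      "filterlim (\<lambda>T. integral {0..T} (\<lambda>s. 1 / \<D> s)) at_top at_top"
      "\<And>x. norm (lie_matrix g V x) \<le> \<D> (V x)"
    and eps: "0 < \<epsilon>"
  shows "\<exists>\<delta> \<xi> :: real \<Rightarrow> real.
    smooth_on {0..} \<delta> \<and> smooth_on {0..} \<xi> \<and> (\<forall>s\<ge>0. 0 \<le> \<delta> s \<and> 0 \<le> \<xi> s) \<and>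
    (let K = (\<lambda>x. - \<xi> (V x) *\<^sub>R lie_matrix g V x);
         \<Phi> = (\<lambda>x d. f x + g x *v (K x + d));
         U = (\<lambda>x. V x + \<delta> (V x) * lie G V x);
         U' = (\<lambda>x. integral {0..U x} (\<lambda>p. 1 / (\<D> (2 * p) + 1)))
     in iISS \<Phi> \<and> smooth_on UNIV U' \<and> iISS_CLF \<Phi> U' \<and> (\<forall>x. norm (K x) \<le> \<epsilon>))"
proof -

  \<comment> \<open>Rates along the undisturbed closed loop\<close>
  define Z where "Z = lie G V"
  define l where "l = lie_matrix g V"
  define lz where "lz = lie_matrix g Z"
  \<comment> \<open>Chosen so that (A3) bounds the feedback at once: its norm is \<epsilon> times
    the norm of \<open>l x\<close> over \<open>\<D> (V x)\<close>.\<close>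
  define \<xi> where "\<xi> s = \<epsilon> / \<D> s" for s
  have F_cont: "continuous_on UNIV F" and g_cont: "continuous_on UNIV g"
    using C_k_on_SucD[of 0 UNIV F] C_k_on_SucD[of 0 UNIV g] F_C1 g_C1 by (simp_all add: One_nat_def del: C_k_on.simps(2))
  have f_cont: "continuous_on UNIV f"
    unfolding f_eq[abs_def] by (rule continuous_on_compose2[OF F_cont]) (auto intro!: continuous_intros)
  note Vd = smooth_on_UNIV_gradient[OF A1(1)] and Zd = smooth_on_UNIV_gradient[OF LGV_smooth, folded Z_def]
  have V_cont: "continuous_on UNIV V"
    using Vd(1) by (meson has_derivative_continuous continuous_at_imp_continuous_on)
  have Z_cont: "continuous_on UNIV Z"
    using Zd(1) by (meson has_derivative_continuous continuous_at_imp_continuous_on)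
  have V00: "V 0 = 0" and V_pos: "\<And>x. x \<noteq> 0 \<Longrightarrow> 0 < V x" and V_inf: "filterlim V at_top at_infinity"
    using A1(2,3) unfolding positive_definite_def radially_unbounded_def by auto
  have V0: "0 \<le> V x" for x using V00 V_pos[of x] by (cases "x = 0") auto
  have l_cont: "continuous_on UNIV l" and lz_cont: "continuous_on UNIV lz"
    unfolding l_def lz_def lie_matrix_def[abs_def] by (intro continuous_on_vector_matrix_mult Vd(2) Zd(2) g_cont)+
  have lie_cont: "continuous_on UNIV (lie f V)" "continuous_on UNIV (lie f Z)"
    unfolding lie_def[abs_def] by (intro continuous_on_inner Vd(2) Zd(2) f_cont)+
  have D_cont: "continuous_on {0..} \<D>" using A3(1) unfolding smooth_on_def by (metis C_k_on.simps(1))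
  have DV_pos: "0 < \<D> (V x)" for x using A3(2) V0 by simp
  have \<xi>_smooth: "smooth_on {0..} \<xi>"
  proof -
    have "C_k_on k {0..} (\<lambda>s. \<epsilon> * inverse (\<D> s))" for k
      using A3(1,2) by (intro C_k_on_mult C_k_on_const C_k_on_inverse thick_Ici) (auto simp: smooth_on_def less_imp_neq[symmetric])
    then show ?thesis by (simp add: smooth_on_def \<xi>_def[abs_def] divide_inverse)
  qed
  have \<xi>V_pos: "0 < \<xi> (V x)" for x using DV_pos eps by (simp add: \<xi>_def)
  have \<xi>V_cont: "continuous_on UNIV (\<lambda>x. \<xi> (V x))"
    unfolding \<xi>_def using DV_pos V0
    by (intro continuous_on_divide continuous_on_const continuous_on_compose2[OF D_cont V_cont])
      (auto simp: less_imp_neq[symmetric])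
  \<comment> \<open>\<open>- A\<close> and \<open>B\<close> are the derivatives of \<open>V\<close>
    and \<open>Z\<close> along the closed loop with d = 0.\<close>
  define A where "A x = \<xi> (V x) * (l x \<bullet> l x) - lie f V x" for x
  define B where "B x = lie f Z x - \<xi> (V x) * (lz x \<bullet> l x)" for x
  have A_cont: "continuous_on S A" and B_cont: "continuous_on S B" for S
    unfolding A_def B_def
    using \<xi>V_cont l_cont lz_cont lie_cont by (auto intro!: continuous_intros elim: continuous_on_subset)
  have \<xi>l: "0 \<le> \<xi> (V x) * (l x \<bullet> l x)" for x
    by (rule mult_nonneg_nonneg[OF less_imp_le[OF \<xi>V_pos] inner_ge_zero])
  have A0: "0 \<le> A x" for x using A1(4)[of x] \<xi>l[of x] unfolding A_def by linarith
  \<comment> \<open>If \<open>A x = 0\<close>, both of its nonnegative parts vanish, so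
    \<open>l x = 0\<close> and \<open>lie f V x = 0\<close>. Then (A2) leaves its first alternative,
    and the feedback term of \<open>B\<close> drops out.\<close>
  have AB: "B x < 0" if "A x = 0" "x \<noteq> 0" for x
  proof -
    have "\<xi> (V x) * (l x \<bullet> l x) = 0" and L: "lie f V x = 0"
      using that(1) A1(4)[of x] \<xi>l[of x] unfolding A_def by linarith+
    then have "l x = 0" using \<xi>V_pos[of x] by simp
    then show ?thesis using A2[OF that(2)] L by (simp add: B_def l_def Z_def)
  qed

  \<comment> \<open>Choice of \<delta> on compact bands\<close>
  define band where "band k = {x. 1 / (real k + 1) \<le> V x \<and> V x \<le> real k + 1}" for k :: nat
  have band_compact: "compact (band k)" for k unfolding band_def by (rule compact_level_band[OF V_cont V_inf])
  have band_nz: "x \<noteq> 0" if "x \<in> band k" for x k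
    using that V00 by (auto simp: band_def divide_le_0_iff)
  \<comment> \<open>In order, the bounds will keep U above V/2, the factor 1 + \<delta>' Z at least
    1/2, and the part \<delta> \<open>lz\<close> of the disturbance coefficient at most 1/2. The
    decrease is measured against A/2 because that factor may be as small as 1/2.\<close>
  have "\<exists>c>0. \<forall>x\<in>band k. (\<forall>\<delta>. \<bar>\<delta>\<bar> \<le> c \<longrightarrow> \<bar>\<delta> * Z x\<bar> \<le> V x / 2 \<and> \<bar>\<delta> * Z x\<bar> \<le> 1 / 2 \<and> \<bar>\<delta> * norm (lz x)\<bar> \<le> 1 / 2) \<and>
      (\<forall>\<delta>. 0 < \<delta> \<and> \<delta> \<le> c \<longrightarrow> \<delta> * B x < A x / 2)" for k
  proof -
    have sub: "continuous_on (band k) h" if "continuous_on UNIV h" for h :: "real^'n \<Rightarrow> real"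
      using that continuous_on_subset by blast
    have "\<exists>c>0. \<forall>x\<in>band k. \<forall>\<delta>. \<bar>\<delta>\<bar> \<le> c \<longrightarrow> \<bar>\<delta> * Z x\<bar> \<le> V x / 2"
      using V_pos band_nz by (intro compact_uniform_smallness band_compact sub Z_cont V_cont continuous_intros) auto
    then obtain c1 where c1: "0 < c1" "\<forall>x\<in>band k. \<forall>\<delta>. \<bar>\<delta>\<bar> \<le> c1 \<longrightarrow> \<bar>\<delta> * Z x\<bar> \<le> V x / 2" by blast
    have "\<exists>c>0. \<forall>x\<in>band k. \<forall>\<delta>. \<bar>\<delta>\<bar> \<le> c \<longrightarrow> \<bar>\<delta> * Z x\<bar> \<le> 1 / 2"
      by (intro compact_uniform_smallness band_compact sub Z_cont continuous_on_const) auto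
    then obtain c2 where c2: "0 < c2" "\<forall>x\<in>band k. \<forall>\<delta>. \<bar>\<delta>\<bar> \<le> c2 \<longrightarrow> \<bar>\<delta> * Z x\<bar> \<le> 1 / 2" by blast
    have "\<exists>c>0. \<forall>x\<in>band k. \<forall>\<delta>. \<bar>\<delta>\<bar> \<le> c \<longrightarrow> \<bar>\<delta> * norm (lz x)\<bar> \<le> 1 / 2"
      by (intro compact_uniform_smallness band_compact sub continuous_on_norm lz_cont continuous_on_const) auto
    then obtain c3 where c3: "0 < c3" "\<forall>x\<in>band k. \<forall>\<delta>. \<bar>\<delta>\<bar> \<le> c3 \<longrightarrow> \<bar>\<delta> * norm (lz x)\<bar> \<le> 1 / 2" by blast
    have "\<exists>c>0. \<forall>x\<in>band k. \<forall>\<delta>. 0 < \<delta> \<and> \<delta> \<le> c \<longrightarrow> \<delta> * B x < A x / 2"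
      using A0 AB band_nz by (intro compact_strict_decrease band_compact continuous_intros A_cont B_cont) auto
    then obtain c4 where c4: "0 < c4" "\<forall>x\<in>band k. \<forall>\<delta>. 0 < \<delta> \<and> \<delta> \<le> c4 \<longrightarrow> \<delta> * B x < A x / 2" by blast
    show ?thesis
      by (rule exI[of _ "min (min c1 c2) (min c3 c4)"]) (use c1 c2 c3 c4 in auto)
  qed
  then obtain c where c: "\<And>k. 0 < c k"
    "\<And>k x \<delta>. x \<in> band k \<Longrightarrow> \<bar>\<delta>\<bar> \<le> c k \<Longrightarrow> \<bar>\<delta> * Z x\<bar> \<le> V x / 2 \<and> \<bar>\<delta> * Z x\<bar> \<le> 1 / 2 \<and> \<bar>\<delta> * norm (lz x)\<bar> \<le> 1 / 2"
    "\<And>k x \<delta>. x \<in> band k \<Longrightarrow> 0 < \<delta> \<Longrightarrow> \<delta> \<le> c k \<Longrightarrow> \<delta> * B x < A x / 2"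
    by metis
  obtain \<delta> \<delta>' :: "real \<Rightarrow> real"
    where \<delta>_smooth: "smooth_on {0..} \<delta>" and \<delta>d: "\<And>v. (\<delta> has_real_derivative \<delta>' v) (at v)" and \<delta>'_cont: "continuous_on UNIV \<delta>'"
    and "\<delta> 0 = 0" and \<delta>0: "\<And>v. 0 \<le> \<delta> v" and \<delta>_pos: "\<And>v. 0 < v \<Longrightarrow> 0 < \<delta> v"
    and \<delta>_small: "\<And>v. 0 < v \<Longrightarrow> \<exists>k. v \<in> {1 / (real k + 1)..real k + 1} \<and> \<delta> v \<le> c k \<and> \<bar>\<delta>' v\<bar> \<le> c k"
    using small_smooth_function[of c] c(1) by metis
  \<comment> \<open>The second bound uses the constraint on \<open>Z\<close> with the derivative in
    the role of \<delta>; one index \<open>k\<close> serves value and derivative.\<close>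
  have small: "\<bar>\<delta> (V x) * Z x\<bar> \<le> V x / 2" "\<bar>\<delta>' (V x) * Z x\<bar> \<le> 1 / 2" "\<delta> (V x) * norm (lz x) \<le> 1 / 2"
    "\<delta> (V x) * B x < A x / 2" if x: "x \<noteq> 0" for x
  proof -
    obtain k where k: "x \<in> band k" "\<delta> (V x) \<le> c k" "\<bar>\<delta>' (V x)\<bar> \<le> c k"
      using \<delta>_small[OF V_pos[OF x]] by (auto simp: band_def)
    show "\<bar>\<delta> (V x) * Z x\<bar> \<le> V x / 2" "\<bar>\<delta>' (V x) * Z x\<bar> \<le> 1 / 2" "\<delta> (V x) * norm (lz x) \<le> 1 / 2"
      using c(2)[OF k(1), of "\<delta> (V x)"] c(2)[OF k(1), of "\<delta>' (V x)"] k(2,3) \<delta>0[of "V x"] by auto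
    show "\<delta> (V x) * B x < A x / 2" using c(3)[OF k(1) \<delta>_pos[OF V_pos[OF x]] k(2)] .
  qed

  \<comment> \<open>The candidate function and its gradient\<close>
  define U where "U x = V x + \<delta> (V x) * Z x" for x
  define gU where "gU x = (1 + \<delta>' (V x) * Z x) *\<^sub>R gradient V x + \<delta> (V x) *\<^sub>R gradient Z x" for x
  define \<theta> where "\<theta> p = 1 / (\<D> (2 * p) + 1)" for p
  define W where "W x = integral {0..U x} \<theta>" for x
  have \<Theta>d: "\<And>r. 0 \<le> r \<Longrightarrow> ((\<lambda>r. integral {0..r} \<theta>) has_real_derivative \<theta> r) (at r within {0..})"
    and \<Theta>_smooth: "smooth_on {0..} (\<lambda>r. integral {0..r} \<theta>)"
    and \<Theta>_pos: "\<And>r. 0 < r \<Longrightarrow> 0 < integral {0..r} \<theta>"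
    and \<Theta>_inf: "filterlim (\<lambda>r. integral {0..r} \<theta>) at_top at_top"
    using integral_reciprocal_reparametrization[of \<D>] A3(1-4) by (simp_all add: \<theta>_def[abs_def])
  have U_half: "V x / 2 \<le> U x" for x
    using small(1)[of x] V00 \<open>\<delta> 0 = 0\<close> by (cases "x = 0") (auto simp: U_def)
  have U00: "U 0 = 0" by (simp add: U_def V00 \<open>\<delta> 0 = 0\<close>)
  have U0: "0 \<le> U x" for x using U_half[of x] V0[of x] by linarith
  have U_smooth: "C_k_on k UNIV U" for k
  proof -
    have "C_k_on k UNIV (\<lambda>x. \<delta> (V x))"
      by (rule C_k_on_compose[where h = \<delta> and u = V, OF thick_UNIV thick_Ici])
        (use \<delta>_smooth A1(1) V0 in \<open>simp_all add: smooth_on_def\<close>)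
    then show ?thesis
      unfolding U_def[abs_def] using A1(1) LGV_smooth
      by (intro C_k_on_add C_k_on_mult thick_UNIV) (simp_all add: smooth_on_def Z_def)
  qed
  have W_smooth: "smooth_on UNIV W"
    unfolding smooth_on_def W_def[abs_def]
  proof
    show "C_k_on k UNIV (\<lambda>x. integral {0..U x} \<theta>)" for k
      by (rule C_k_on_compose[where h = "\<lambda>r. integral {0..r} \<theta>" and u = U, OF thick_UNIV thick_Ici])
        (use \<Theta>_smooth U_smooth U0 in \<open>simp_all add: smooth_on_def\<close>)
  qed
  have Ud: "(U has_derivative (\<lambda>v. gU x \<bullet> v)) (at x)" for x
  proof -
    have "((\<lambda>x. \<delta> (V x)) has_derivative (\<lambda>v. (gradient V x \<bullet> v) * \<delta>' (V x))) (at x)"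
      by (rule DERIV_compose_FDERIV[where f = \<delta> and g = V, OF \<delta>d Vd(1)])
    then have "(U has_derivative (\<lambda>v. gradient V x \<bullet> v +
        (\<delta> (V x) * (gradient Z x \<bullet> v) + (gradient V x \<bullet> v) * \<delta>' (V x) * Z x))) (at x)"
      unfolding U_def[abs_def] by (intro has_derivative_add Vd(1) has_derivative_mult Zd(1))
    then show ?thesis
      by (rule has_derivative_eq_rhs) (auto simp: gU_def inner_add_left algebra_simps)
  qed
  have Wd: "(W has_derivative (\<lambda>v. (\<theta> (U x) *\<^sub>R gU x) \<bullet> v)) (at x)" for x
  proof -
    have "((\<lambda>x. integral {0..U x} \<theta>) has_derivative (\<lambda>v. \<theta> (U x) * (gU x \<bullet> v))) (at x)"
      by (rule has_derivative_in_compose2[where t = "{0..}" and g = "\<lambda>r. integral {0..r} \<theta>" and g' = "\<lambda>r v. \<theta> r * v" and s = UNIV])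
        (use \<Theta>d U0 Ud in \<open>auto simp: has_field_derivative_def\<close>)
    then show ?thesis by (simp add: W_def[abs_def])
  qed
  have gW: "gradient W x = \<theta> (U x) *\<^sub>R gU x" for x by (rule gradient_eqI[OF Wd])
  have \<theta>_pos: "0 < \<theta> (U x)" for x using A3(2)[of "2 * U x"] U0[of x] by (simp add: \<theta>_def)
  \<comment> \<open>The bounds in \<open>small\<close> exclude the origin, which is treated apart: 0
    minimizes \<open>V\<close>, so its gradient vanishes there, and with
    \<open>\<delta> 0 = 0\<close> so does that of \<open>U\<close>.\<close>
  have gV0: "gradient V 0 = 0"
  proof -
    have "(\<lambda>v. gradient V 0 \<bullet> v) = (\<lambda>v. 0)"
      by (rule has_derivative_local_min[OF Vd(1)]) (simp add: V00 V0)
    then show ?thesis by (metis inner_eq_zero_iff)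
  qed
  have gU0: "gU 0 = 0" by (simp add: gU_def gV0 V00 \<open>\<delta> 0 = 0\<close>)
  have W_cont_grad: "continuous_on UNIV (gradient W)" by (rule smooth_on_UNIV_gradient(2)[OF W_smooth])
  have W_pd: "positive_definite W"
    unfolding positive_definite_def
  proof (intro conjI allI impI)
    show "W 0 = 0" by (simp add: W_def U00)
    show "0 < W x" if "x \<noteq> 0" for x
      unfolding W_def using V_pos[OF that] U_half[of x] by (intro \<Theta>_pos) linarith
  qed
  have W_ru: "radially_unbounded W"
  proof -
    have "filterlim (\<lambda>x. 1 / 2 * V x) at_top at_infinity"
      by (rule filterlim_tendsto_pos_mult_at_top[OF tendsto_const _ V_inf]) simp
    then have "filterlim U at_top at_infinity"
      by (rule filterlim_at_top_mono) (use U_half in simp)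
    then show ?thesis unfolding radially_unbounded_def W_def[abs_def] by (rule filterlim_compose[OF \<Theta>_inf])
  qed

  \<comment> \<open>Dissipation and conclusion\<close>
  define K where "K x = - \<xi> (V x) *\<^sub>R l x" for x
  define \<Phi> where "\<Phi> x d = f x + g x *v (K x + d)" for x d
  \<comment> \<open>The exact decay rate without disturbance: continuity is then immediate, and
    positivity off the origin is what has to be shown.\<close>
  define R where "R x = - (gradient W x \<bullet> \<Phi> x 0)" for x
  have R_cont: "continuous_on UNIV R"
    unfolding R_def \<Phi>_def K_def
    by (intro continuous_intros W_cont_grad f_cont continuous_on_matrix_vector_mult \<xi>V_cont l_cont g_cont)
  have R_0: "R 0 = 0" by (simp add: R_def gW gU0)
  have R_pos: "0 < R x" if x: "x \<noteq> 0" for x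
  proof -
    have "gradient V x \<bullet> \<Phi> x 0 = - A x"
      by (simp add: \<Phi>_def inner_add_right dot_lmul_matrix[symmetric] K_def A_def l_def lie_matrix_def lie_def algebra_simps)
    moreover have "gradient Z x \<bullet> \<Phi> x 0 = B x"
      by (simp add: \<Phi>_def inner_add_right dot_lmul_matrix[symmetric] K_def B_def l_def lz_def lie_matrix_def lie_def algebra_simps)
    ultimately have "gU x \<bullet> \<Phi> x 0 = - ((1 + \<delta>' (V x) * Z x) * A x) + \<delta> (V x) * B x"
      by (simp add: gU_def inner_add_left)
    \<comment> \<open>Together with \<delta> B < A/2 this makes the derivative of \<open>U\<close>
      negative.\<close>
    moreover have "1 / 2 * A x \<le> (1 + \<delta>' (V x) * Z x) * A x"
      using small(2)[OF x] A0[of x] by (intro mult_right_mono) (auto simp: abs_le_iff)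
    ultimately have "gU x \<bullet> \<Phi> x 0 < 0" using small(4)[OF x] by linarith
    then show ?thesis using \<theta>_pos[of x] by (simp add: R_def gW mult_pos_neg)
  qed
  \<comment> \<open>The disturbance enters linearly through \<open>gU x v* g x\<close>, whose norm
    off the origin is at most 3/2 D(V) + 1/2. As V <= 2 U, this is at most 3/2 (D(2 U) + 1), and
    \<open>\<theta> (U x)\<close> cancels the last factor.\<close>
  have dissip: "gradient W x \<bullet> \<Phi> x d \<le> - R x + 3 / 2 * norm d" for x d
  proof -
    have "gradient W x \<bullet> \<Phi> x d = - R x + \<theta> (U x) * ((gU x v* g x) \<bullet> d)"
      by (simp add: R_def \<Phi>_def gW inner_add_right dot_lmul_matrix matrix_vector_right_distrib algebra_simps)
    moreover have "\<theta> (U x) * ((gU x v* g x) \<bullet> d) \<le> 3 / 2 * norm d"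
    proof (cases "x = 0")
      case False
      have "gU x v* g x = (1 + \<delta>' (V x) * Z x) *\<^sub>R l x + \<delta> (V x) *\<^sub>R lz x"
        by (simp add: gU_def l_def lz_def lie_matrix_def vector_matrix_left_distrib scaleR_vector_matrix_assoc)
      then have "norm (gU x v* g x) \<le> \<bar>1 + \<delta>' (V x) * Z x\<bar> * norm (l x) + \<delta> (V x) * norm (lz x)"
        using norm_triangle_ineq[of "(1 + \<delta>' (V x) * Z x) *\<^sub>R l x" "\<delta> (V x) *\<^sub>R lz x"] \<delta>0[of "V x"] by simp
      also have "\<dots> \<le> 3 / 2 * \<D> (V x) + 1 / 2"
        using small(2,3)[OF False] A3(5)[of x] by (intro add_mono mult_mono) (auto simp: l_def abs_le_iff)
      also have "\<dots> \<le> 3 / 2 * (\<D> (2 * U x) + 1)"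
        using mono_onD[OF A3(3), of "V x" "2 * U x"] U_half[of x] V0[of x] U0[of x] by auto
      finally have "norm (gU x v* g x) * norm d \<le> 3 / 2 * (\<D> (2 * U x) + 1) * norm d" by (rule mult_right_mono) simp
      then have "(gU x v* g x) \<bullet> d \<le> 3 / 2 * (\<D> (2 * U x) + 1) * norm d"
        using norm_cauchy_schwarz[of "gU x v* g x" d] by linarith
      then have "\<theta> (U x) * ((gU x v* g x) \<bullet> d) \<le> \<theta> (U x) * (3 / 2 * (\<D> (2 * U x) + 1) * norm d)"
        using \<theta>_pos[of x] by (intro mult_left_mono) auto
      also have "\<dots> = 3 / 2 * norm d * (\<theta> (U x) * (\<D> (2 * U x) + 1))" by (simp add: algebra_simps)
      also have "\<theta> (U x) * (\<D> (2 * U x) + 1) = 1" using \<theta>_pos[of x] by (simp add: \<theta>_def)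
      finally show ?thesis by simp
    qed (simp add: gU0 dot_lmul_matrix)
    ultimately show ?thesis by linarith
  qed
  have "iISS \<Phi> \<and> iISS_CLF \<Phi> W"
    by (rule iISS_of_dissipation[OF smooth_on_UNIV_gradient[OF W_smooth] W_pd W_ru R_cont R_0 R_pos _ dissip]) simp_all
  moreover have "norm (K x) \<le> \<epsilon>" for x
  proof -
    have "norm (K x) = \<xi> (V x) * norm (l x)" using \<xi>V_pos[of x] by (simp add: K_def)
    also have "\<dots> \<le> \<xi> (V x) * \<D> (V x)" using \<xi>V_pos[of x] A3(5)[of x] by (intro mult_left_mono) (auto simp: l_def)
    also have "\<dots> = \<epsilon>" using DV_pos[of x] by (simp add: \<xi>_def)
    finally show ?thesis .
  qed
  moreover have "0 \<le> \<xi> s" if "0 \<le> s" for s using A3(2)[OF that] eps by (simp add: \<xi>_def)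
  ultimately show ?thesis
    using \<delta>_smooth \<xi>_smooth \<delta>0 W_smooth
    unfolding Let_def W_def[abs_def] U_def[abs_def] \<Phi>_def[abs_def] K_def[abs_def] \<theta>_def[abs_def] l_def Z_def
    by (intro exI[of _ \<delta>] exI[of _ \<xi>]) simp
qed

end
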